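(* Let $\Theta=(C_1,C_2,b)$ with $0<b<\min(C_1,C_2)$ be fixed. Let $\phi$ be a Schwartz function on $\mathbb{R}$ with $\operatorname{supp}\widehat\phi\subset(-\delta,\delta)$. Let $E=\{T_k^*\}$ be a (countable) well-separated collection of partial tents, $T_k^*\subset T(x_k,\xi_k,s_k)$, with separation constants $\alpha\ge1$, $\beta\ge4\delta$ and $B>1$. Let $s\in(0,1)$. Then for every $f\in L^2(\mathbb{R})$, $$\Big(\int_{\bigcup_kT_k^*}|\langle f,\phi_{y,\eta,t}\rangle|^2\,dy\,d\eta\,dt\Big)^{1/2}\le C\left(\|f\|_2+\Big[\sup_{(y,\eta,t)\in\bigcup_kT_k^*}|\langle f,\phi_{y,\eta,t}\rangle|\,\Big(\sum_ks_k\Big)^{1/2}\Big]^{s}\|f\|_2^{1-s}\right),$$ where $C$ depends only on $\phi$, $\Theta$, $B$, $\beta$ and $s$.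
   Context: Fourier transform: $\widehat f(\xi)=\int_{\mathbb{R}}e^{-i\xi x}f(x)\,dx$. $\langle f,g\rangle=\int_{\mathbb{R}} f\overline g$. Let $X=\mathbb{R}\times\mathbb{R}\times(0,\infty)$. For $(y,\eta,t)\in X$ the wave packet is $\phi_{y,\eta,t}(x)=e^{-i\eta(y-x)}\frac1t\overline{\phi(\frac{y-x}{t})}$. For $(x,\xi,s)\in X$ the tent is $T(x,\xi,s)=\{(y,\eta,t)\in X: t<s,\ |y-x|<s-t,\ -C_1/t<\eta-\xi<C_2/t\}$; all tents use the same $\Theta$. A partial tent is a (measurable) subset of a tent. A collection of pairwise disjoint partial tents $\{T_k^*\}$, $T_k^*\subset T(x_k,\xi_k,s_k)$, is well-separated with separation constants $\alpha\ge1$, $\beta>0$, $B>1$ if: whenever $(y,\eta,t)\in T_k^*$ and $(y',\eta',t')\in\bigcup_jT_j^*$ satisfy $Bt'<t$, then either $|\eta-\eta'|>\beta(t')^{-1}$ or $|x_k-y'|>\alpha(s_k-t')$. *)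

theory Defs
  imports "HOL-Analysis.Analysis"
begin

definition fourier :: "(real \<Rightarrow> complex) \<Rightarrow> real \<Rightarrow> complex" where
  "fourier f \<xi> = (LINT x|lebesgue. exp (- (\<i> * complex_of_real (\<xi> * x))) * f x)"

abbreviation vderiv :: "(real \<Rightarrow> complex) \<Rightarrow> real \<Rightarrow> complex" where
  "vderiv g \<equiv> (\<lambda>x. vector_derivative g (at x))"

definition schwartz :: "(real \<Rightarrow> complex) \<Rightarrow> bool" where
  "schwartz f \<longleftrightarrow>
     (\<forall>n. (\<forall>x. ((vderiv ^^ n) f) differentiable (at x)) \<and>
          (\<forall>m::nat. \<exists>K. \<forall>x. \<bar>x\<bar> ^ m * norm (((vderiv ^^ n) f) x) \<le> K))"

definition supp :: "(real \<Rightarrow> complex) \<Rightarrow> real set" where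
  "supp g = closure {\<xi>. g \<xi> \<noteq> 0}"

(* Functions rather than equivalence classes modulo null sets; everything below
   depends only on the class. *)
definition in_L2 :: "(real \<Rightarrow> complex) \<Rightarrow> bool" where
  "in_L2 f \<longleftrightarrow> f \<in> borel_measurable lebesgue \<and> integrable lebesgue (\<lambda>x. (norm (f x))\<^sup>2)"

definition L2_inner :: "(real \<Rightarrow> complex) \<Rightarrow> (real \<Rightarrow> complex) \<Rightarrow> complex" where
  "L2_inner f g = (LINT x|lebesgue. f x * cnj (g x))"

definition norm_L2 :: "(real \<Rightarrow> complex) \<Rightarrow> real" where
  "norm_L2 f = sqrt (LINT x|lebesgue. (norm (f x))\<^sup>2)"

definition wave_packet ::
  "(real \<Rightarrow> complex) \<Rightarrow> real \<times> real \<times> real \<Rightarrow> real \<Rightarrow> complex" where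
  "wave_packet \<phi> = (\<lambda>(y, \<eta>, t) x.
     exp (- (\<i> * complex_of_real (\<eta> * (y - x)))) * complex_of_real (1 / t) * cnj (\<phi> ((y - x) / t)))"

(* The third component b of the parameter triple (C1, C2, b) does not enter the tent itself. *)
definition tent :: "real \<times> real \<times> real \<Rightarrow> real \<Rightarrow> real \<Rightarrow> real \<Rightarrow> (real \<times> real \<times> real) set" where
  "tent = (\<lambda>(C1, C2, b) x \<xi> s.
     {(y, \<eta>, t). 0 < t \<and> t < s \<and> \<bar>y - x\<bar> < s - t \<and> - (C1 / t) < \<eta> - \<xi> \<and> \<eta> - \<xi> < C2 / t})"

(* The collection is indexed by a set of naturals, hence finite or countably infinite. *)
definition partial_tents ::
  "real \<times> real \<times> real \<Rightarrow> nat set \<Rightarrow> (nat \<Rightarrow> real) \<Rightarrow> (nat \<Rightarrow> real) \<Rightarrow> (nat \<Rightarrow> real) \<Rightarrow>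
   (nat \<Rightarrow> (real \<times> real \<times> real) set) \<Rightarrow> bool" where
  "partial_tents \<Theta> I x \<xi> s T \<longleftrightarrow>
     (\<forall>k\<in>I. 0 < s k \<and> T k \<in> sets lebesgue \<and> T k \<subseteq> tent \<Theta> (x k) (\<xi> k) (s k))"

(* The case j = k is included in the separation condition. *)
definition well_separated ::
  "real \<times> real \<times> real \<Rightarrow> real \<Rightarrow> real \<Rightarrow> real \<Rightarrow>
   nat set \<Rightarrow> (nat \<Rightarrow> real) \<Rightarrow> (nat \<Rightarrow> real) \<Rightarrow> (nat \<Rightarrow> real) \<Rightarrow>
   (nat \<Rightarrow> (real \<times> real \<times> real) set) \<Rightarrow> bool" where
  "well_separated \<Theta> \<alpha> \<beta> B I x \<xi> s T \<longleftrightarrow>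
     1 \<le> \<alpha> \<and> 0 < \<beta> \<and> 1 < B \<and>
     partial_tents \<Theta> I x \<xi> s T \<and> disjoint_family_on T I \<and>
     (\<forall>k\<in>I. \<forall>(y, \<eta>, t) \<in> T k. \<forall>(y', \<eta>', t') \<in> (\<Union>j\<in>I. T j).
        B * t' < t \<longrightarrow> \<beta> / t' < \<bar>\<eta> - \<eta>'\<bar> \<or> \<alpha> * (s k - t') < \<bar>x k - y'\<bar>)"

(* Power with a positive real exponent p on [0, \<infinity>], with \<infinity> powr p = \<infinity>. *)
definition ennpow :: "ennreal \<Rightarrow> real \<Rightarrow> ennreal" where
  "ennpow x p = (if x = \<infinity> then \<infinity> else ennreal (enn2real x powr p))"

end

theory Submission
  imports Defs "HOL-Probability.Probability"
begin

text \<open>The proof is a TT* argument. Write F p for the wave packet coefficient of f at p and let P be the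
  union of the partial tents. Since 2 l Re(f, g) is at most l^2 |f|^2 + |g|^2, testing f against the
  superposition g of the wave packets with coefficients F p, p in P, bounds the energy (the integral of
  |F|^2 over P) by |f|^2 plus the double integral over P x P of |F p| |F q| |(phi_p, phi_q)|.

  Wave packets with disjoint frequency supports are orthogonal, so only q of smaller scale t' whose
  frequency is within 2 delta / t' of that of p interact with p. Separation implies that over a fixed
  point y' these q have comparable scales, so the rows of the interaction kernel have
  uniformly bounded integrals; it also pushes the q of much smaller scale out of the tent of p, which makes the
  interaction between far scales, integrated over one tent, at most a constant times its width s_k.

  The row bound alone shows that a set on which |F| is constant up to a factor 2 has energy at most a
  constant times |f|^2. The tail bound shows the same for the set where |F| is at most
  |f| / (sum s_k)^(1/2). The remaining part of P consists of about log r dyadic levels, where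
  r = sup |F| (sum s_k)^(1/2) / |f|, and the logarithm is absorbed by r^(2 sigma).\<close>

section \<open>Orthogonality from disjoint Fourier supports\<close>

text \<open>The obstacle is that separation bounds the rows of the kernel (q of smaller scale than
  p) but gives no bound for its columns, so Schur's test is available only for comparable scales.
  Two substitutes replace a column bound: on a level set F q can be exchanged for 2 F p, and on the
  low set |F| is replaced by its upper bound while the row bounds are integrated over tents. The
  weight l is a multiple of the row constant, chosen so that the part of the double integral
  proportional to the energy is half of the left side and can be subtracted. Subtraction needs
  finite energy, which is known beforehand only on sets of finite measure with scales bounded below;
  the estimates are therefore proved on such truncations, with constants independent of the
  truncation. The band limit used throughout is \<beta> / 4. Two frequency windows of radius 2
  (\<beta> / 4) / t then add up to the separation threshold \<beta> / t, and the constants do not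
  involve the support radius of the transform.\<close>

lemma borel_measurable_cnj [measurable (raw)]:
  "f \<in> borel_measurable M \<Longrightarrow> (\<lambda>x. cnj (f x)) \<in> borel_measurable M"
  by (rule borel_measurable_continuous_on[OF continuous_on_cnj[OF continuous_on_id]])

text \<open>Supplies the integrability behind both exchanges of integrals in
  \<open>gauss_regularized_inner\<close>: a bounded factor over a probability space preserves
  integrability.\<close>

lemma integrable_pair_prob:
  fixes g :: "'a \<Rightarrow> complex" and b :: "'a \<times> 'b \<Rightarrow> complex"
  assumes M: "sigma_finite_measure M" and N: "prob_space N"
    and g: "integrable M g" and b [measurable]: "b \<in> borel_measurable (M \<Otimes>\<^sub>M N)"
    and bd: "\<And>z. norm (b z) \<le> K"
  shows "integrable (M \<Otimes>\<^sub>M N) (\<lambda>(x, y). g x * b (x, y))"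
proof -
  interpret M: sigma_finite_measure M by fact
  interpret N: prob_space N by fact
  interpret pair_sigma_finite M N ..
  have [measurable]: "g \<in> borel_measurable M" using g by auto
  have "integrable (M \<Otimes>\<^sub>M N) (\<lambda>(x, y). g x)"
    by (rule Fubini_integrable) (use g N.prob_space in auto)
  then have *: "integrable (M \<Otimes>\<^sub>M N) (\<lambda>z. K * norm (g (fst z)))"
    by (auto simp: case_prod_unfold)
  show ?thesis
  proof (rule Bochner_Integration.integrable_bound[OF *])
    show "AE z in M \<Otimes>\<^sub>M N. norm (case z of (x, y) \<Rightarrow> g x * b (x, y)) \<le> norm (K * norm (g (fst z)))"
    proof (rule AE_I2)
      fix z have "norm (b z) * norm (g (fst z)) \<le> \<bar>K\<bar> * norm (g (fst z))"
        by (intro mult_right_mono order_trans[OF bd]) auto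
      then show "norm (case z of (x, y) \<Rightarrow> g x * b (x, y)) \<le> norm (K * norm (g (fst z)))"
        by (simp add: case_prod_unfold norm_mult abs_mult mult.commute)
    qed
  qed (auto simp: case_prod_unfold)
qed

lemma iexp_std_normal: "(LINT \<xi>|std_normal_distribution. iexp (\<xi> * v)) = complex_of_real (exp (- v\<^sup>2 / 2))"
  using fun_cong[OF char_std_normal_distribution, of v] by (simp add: char_def mult.commute)

text \<open>The substitution z = x - u / c turns an integral against a Gaussian of width 1 / c into
  a mean over a standard normal u; \<open>sqrt (2 * pi) / c\<close> is the mass of that
  Gaussian.\<close>

lemma gauss_convolution:
  fixes h :: "real \<Rightarrow> complex"
  assumes c: "c > 0" and [measurable]: "h \<in> borel_measurable borel"
  shows "(LBINT z. h z * complex_of_real (exp (- (c * (x - z))\<^sup>2 / 2)))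
    = (sqrt (2 * pi) / c) *\<^sub>R (LINT u|std_normal_distribution. h (x - u / c))"
proof -
  have "(LBINT z. h z * complex_of_real (exp (- (c * (x - z))\<^sup>2 / 2)))
     = \<bar>- 1 / c\<bar> *\<^sub>R (LBINT u. h (x + (- 1 / c) * u) * complex_of_real (exp (- (c * (x - (x + (- 1 / c) * u)))\<^sup>2 / 2)))"
    using c by (intro lborel_integral_real_affine) auto
  also have "(\<lambda>u. h (x + (- 1 / c) * u) * complex_of_real (exp (- (c * (x - (x + (- 1 / c) * u)))\<^sup>2 / 2)))
     = (\<lambda>u. sqrt (2 * pi) *\<^sub>R (std_normal_density u *\<^sub>R h (x - u / c)))"
    using c by (intro ext) (simp add: std_normal_density_def scaleR_conv_of_real mult.commute)
  also have "(LBINT u. sqrt (2 * pi) *\<^sub>R (std_normal_density u *\<^sub>R h (x - u / c)))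
     = sqrt (2 * pi) *\<^sub>R (LINT u|std_normal_distribution. h (x - u / c))"
    unfolding integral_scaleR_right by (subst integral_density) (auto simp: normal_density_nonneg)
  finally show ?thesis using c by simp
qed

text \<open>The Gaussian is the characteristic function of the standard normal law, hence a mean of
  the characters \<open>iexp (\<xi> * (c * (x - z)))\<close>. Two uses of Fubini rewrite the double
  integral as the mean over \<xi> of the transform of g at - c \<xi> times the conjugate transform
  of h there, and one of the two always vanishes. Averaging over a probability law is what makes
  Fubini applicable to functions that are merely integrable.\<close>

lemma gauss_regularized_inner:
  fixes g h :: "real \<Rightarrow> complex"
  assumes g: "integrable lborel g" and h: "integrable lborel h"
    and orth: "\<And>\<xi>. (LBINT x. iexp (- (\<xi> * x)) * g x) = 0 \<or> (LBINT x. iexp (- (\<xi> * x)) * h x) = 0"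
  shows "(LBINT x. g x * (LBINT z. cnj (h z) * complex_of_real (exp (- (c * (x - z))\<^sup>2 / 2)))) = 0"
proof -
  let ?N = std_normal_distribution
  interpret N: real_distribution ?N by (rule real_dist_normal_dist)
  interpret pair_sigma_finite lborel ?N ..
  have Np: "prob_space ?N" by unfold_locales
  note sl = sigma_finite_lborel
  have [measurable]: "g \<in> borel_measurable borel" "h \<in> borel_measurable borel" using g h by auto
  have ih: "integrable lborel (\<lambda>z. cnj (h z))" using h by simp
  have inner: "(LBINT z. cnj (h z) * complex_of_real (exp (- (c * (x - z))\<^sup>2 / 2)))
     = (LINT \<xi>|?N. iexp (c * \<xi> * x) * cnj (LBINT z. iexp (- ((- c * \<xi>) * z)) * h z))" for x
  proof -
    have "(LBINT z. cnj (h z) * complex_of_real (exp (- (c * (x - z))\<^sup>2 / 2)))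
      = (LBINT z. (LINT \<xi>|?N. cnj (h z) * iexp (\<xi> * (c * (x - z)))))"
      by (simp only: integral_mult_right_zero iexp_std_normal)
    also have "\<dots> = (LINT \<xi>|?N. (LBINT z. cnj (h z) * iexp (\<xi> * (c * (x - z)))))"
    proof (rule Fubini_integral[symmetric])
      show "integrable (lborel \<Otimes>\<^sub>M ?N) (\<lambda>(z, \<xi>). cnj (h z) * iexp (\<xi> * (c * (x - z))))"
        using integrable_pair_prob[OF sl Np ih, of "\<lambda>w. iexp (snd w * (c * (x - fst w)))" 1] by simp
    qed
    also have "(\<lambda>\<xi>. LBINT z. cnj (h z) * iexp (\<xi> * (c * (x - z))))
       = (\<lambda>\<xi>. LBINT z. iexp (c * \<xi> * x) * cnj (iexp (- ((- c * \<xi>) * z)) * h z))"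
      by (intro ext Bochner_Integration.integral_cong) (auto simp: exp_cnj exp_add[symmetric] algebra_simps)
    finally show ?thesis by (simp only: integral_mult_right_zero Bochner_Integration.integral_cnj)
  qed
  define H where "H \<xi> = (LBINT z. iexp (- (\<xi> * z)) * h z)" for \<xi>
  have bd: "norm (H \<xi>) \<le> (LBINT z. norm (h z))" for \<xi>
    unfolding H_def by (rule order_trans[OF integral_norm_bound]) (simp add: norm_mult)
  have [measurable]: "H \<in> borel_measurable borel"
    unfolding H_def[abs_def] by measurable
  have "(LBINT x. g x * (LBINT z. cnj (h z) * complex_of_real (exp (- (c * (x - z))\<^sup>2 / 2))))
     = (LBINT x. (LINT \<xi>|?N. g x * (iexp (c * \<xi> * x) * cnj (H (- c * \<xi>)))))"
    unfolding inner H_def[symmetric] by simp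
  also have "\<dots> = (LINT \<xi>|?N. (LBINT x. g x * (iexp (c * \<xi> * x) * cnj (H (- c * \<xi>)))))"
  proof (rule Fubini_integral[symmetric])
    show "integrable (lborel \<Otimes>\<^sub>M ?N) (\<lambda>(x, \<xi>). g x * (iexp (c * \<xi> * x) * cnj (H (- c * \<xi>))))"
      using integrable_pair_prob[OF sl Np g, of "\<lambda>w. iexp (c * snd w * fst w) * cnj (H (- c * snd w))" "LBINT z. norm (h z)"] bd
      by (simp add: norm_mult)
  qed
  also have "\<dots> = (LINT \<xi>|?N. 0)"
  proof (rule Bochner_Integration.integral_cong)
    fix \<xi>
    have "(LBINT x. g x * (iexp (c * \<xi> * x) * cnj (H (- c * \<xi>))))
      = (LBINT x. (iexp (- ((- c * \<xi>) * x)) * g x) * cnj (H (- c * \<xi>)))"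
      by (rule Bochner_Integration.integral_cong) auto
    also have "\<dots> = 0"
      unfolding integral_mult_left_zero using orth[of "- c * \<xi>"] by (auto simp: H_def)
    finally show "(LBINT x. g x * (iexp (c * \<xi> * x) * cnj (H (- c * \<xi>)))) = 0" .
  qed auto
  finally show ?thesis by simp
qed

text \<open>The Gaussian of the regularized version is narrowed by taking c = n + 1: the means
  \<open>J n\<close> converge pointwise to cnj h by continuity and stay below K, so dominated
  convergence applies first in u and then in x.\<close>

lemma fourier_disjoint_orthogonal:
  fixes g h :: "real \<Rightarrow> complex"
  assumes g: "integrable lborel g" and h: "integrable lborel h"
    and hc: "continuous_on UNIV h" and hb: "\<And>x. norm (h x) \<le> K"
    and orth: "\<And>\<xi>. (LBINT x. iexp (- (\<xi> * x)) * g x) = 0 \<or> (LBINT x. iexp (- (\<xi> * x)) * h x) = 0"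
  shows "(LBINT x. g x * cnj (h x)) = 0"
proof -
  let ?N = std_normal_distribution
  interpret N: real_distribution ?N by (rule real_dist_normal_dist)
  have [measurable]: "g \<in> borel_measurable borel" "h \<in> borel_measurable borel" using g h by auto
  define J where "J n x = (LINT u|?N. cnj (h (x - u / real (Suc n))))" for n x
  have Jb: "norm (J n x) \<le> K" for n x
  proof -
    have "norm (J n x) \<le> (LINT u|?N. norm (h (x - u / real (Suc n))))"
      unfolding J_def by (rule order_trans[OF integral_norm_bound]) simp
    also have "\<dots> \<le> (LINT u|?N. K)"
      by (rule integral_mono) (auto intro!: N.integrable_const_bound[where B=K] simp: hb)
    finally show ?thesis using N.prob_space by simp
  qed
  have Jl: "(\<lambda>n. J n x) \<longlonglongrightarrow> cnj (h x)" for x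
  proof -
    have "(\<lambda>n. J n x) \<longlonglongrightarrow> (LINT u|?N. cnj (h x))"
      unfolding J_def
    proof (rule integral_dominated_convergence[where w="\<lambda>_. K"])
      show "AE u in ?N. (\<lambda>n. cnj (h (x - u / real (Suc n)))) \<longlonglongrightarrow> cnj (h x)"
      proof (rule AE_I2)
        fix u :: real
        have "(\<lambda>n. u / real (Suc n)) \<longlonglongrightarrow> 0" 
          using LIMSEQ_inverse_real_of_nat[THEN tendsto_mult_left, of u] by (simp add: field_simps)
        then have "(\<lambda>n. x - u / real (Suc n)) \<longlonglongrightarrow> x"
          using tendsto_diff[OF tendsto_const[of x]] by fastforce
        then have "(\<lambda>n. h (x - u / real (Suc n))) \<longlonglongrightarrow> h x"
          using hc by (intro isCont_tendsto_compose[of x h]) (simp_all add: continuous_on_eq_continuous_at)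
        then show "(\<lambda>n. cnj (h (x - u / real (Suc n)))) \<longlonglongrightarrow> cnj (h x)"
          by (rule tendsto_cnj)
      qed
    qed (auto simp: hb simp del: of_nat_Suc)
    then show ?thesis using N.prob_space by simp
  qed
  have J0: "(LBINT x. g x * J n x) = 0" for n
  proof -
    have "(LBINT x. g x * ((sqrt (2 * pi) / real (Suc n)) *\<^sub>R J n x)) = 0"
      using gauss_regularized_inner[OF g h orth, of "real (Suc n)"]
      unfolding J_def by (subst (asm) gauss_convolution) auto
    then have "(LBINT x. (sqrt (2 * pi) / real (Suc n)) *\<^sub>R (g x * J n x)) = 0"
      by (simp only: mult_scaleR_right)
    then show ?thesis by (simp del: of_nat_Suc)
  qed
  have [measurable]: "J n \<in> borel_measurable borel" for n
    unfolding J_def[abs_def] by measurable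
  have "(\<lambda>n. LBINT x. g x * J n x) \<longlonglongrightarrow> (LBINT x. g x * cnj (h x))"
  proof (rule integral_dominated_convergence[where w="\<lambda>x. norm (g x) * K"])
    show "AE x in lborel. (\<lambda>n. g x * J n x) \<longlonglongrightarrow> g x * cnj (h x)"
      by (intro AE_I2 tendsto_mult_left Jl)
    show "integrable lborel (\<lambda>x. norm (g x) * K)" using g by auto
    show "AE x in lborel. norm (g x * J n x) \<le> norm (g x) * K" for n
      by (intro AE_I2) (simp add: norm_mult mult_left_mono Jb)
  qed measurable
  then show ?thesis by (simp add: J0 LIMSEQ_const_iff)
qed

section \<open>The TT* inequality\<close>

text \<open>Here g superposes the vectors \<open>\<Psi> p\<close>: integrating (f, \<Psi> p) over p
  gives (f, g), and the squared norm of g is the double integral of (\<Psi> p, \<Psi> q). The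
  assumptions \<open>fin1\<close> and \<open>fin2\<close> are the absolute convergence that Fubini
  needs for these two identities.\<close>

lemma TTstar_inequality:
  fixes \<Psi> :: "'p \<Rightarrow> 'x \<Rightarrow> complex"
  assumes M: "sigma_finite_measure M" and N: "sigma_finite_measure N"
    and \<Psi> [measurable]: "(\<lambda>(p, x). \<Psi> p x) \<in> borel_measurable (M \<Otimes>\<^sub>M N)"
    and f [measurable]: "f \<in> borel_measurable N" and f2: "integrable N (\<lambda>x. (norm (f x))\<^sup>2)"
    and fin1: "(\<integral>\<^sup>+p. \<integral>\<^sup>+x. ennreal (norm (\<Psi> p x) * norm (f x)) \<partial>N \<partial>M) < \<infinity>"
    and fin2: "(\<integral>\<^sup>+p. \<integral>\<^sup>+q. \<integral>\<^sup>+x. ennreal (norm (\<Psi> p x) * norm (\<Psi> q x)) \<partial>N \<partial>M \<partial>M) < \<infinity>"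
    and l: "l > 0"
  shows "ennreal (2 * l * Re (LINT p|M. (LINT x|N. f x * cnj (\<Psi> p x))))
    \<le> ennreal (l\<^sup>2 * (LINT x|N. (norm (f x))\<^sup>2))
      + (\<integral>\<^sup>+p. \<integral>\<^sup>+q. ennreal (norm (LINT x|N. \<Psi> p x * cnj (\<Psi> q x))) \<partial>M \<partial>M)"
proof -
  interpret M: sigma_finite_measure M by fact
  interpret N: sigma_finite_measure N by fact
  interpret MN: pair_sigma_finite M N ..
  interpret MM: pair_sigma_finite M M ..
  interpret MMN: pair_sigma_finite "M \<Otimes>\<^sub>M M" N ..
  define g where "g x = (LINT p|M. \<Psi> p x)" for x
  define h where "h w x = \<Psi> (fst w) x * cnj (\<Psi> (snd w) x)" for w x
  have h_meas [measurable]: "case_prod h \<in> borel_measurable ((M \<Otimes>\<^sub>M M) \<Otimes>\<^sub>M N)"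
    unfolding h_def[abs_def] by measurable
  have int1: "integrable (M \<Otimes>\<^sub>M N) (\<lambda>(p, x). f x * cnj (\<Psi> p x))"
  proof (rule integrableI_bounded)
    have "(\<integral>\<^sup>+z. ennreal (norm (case z of (p, x) \<Rightarrow> f x * cnj (\<Psi> p x))) \<partial>(M \<Otimes>\<^sub>M N))
      = (\<integral>\<^sup>+p. \<integral>\<^sup>+x. ennreal (norm (\<Psi> p x) * norm (f x)) \<partial>N \<partial>M)"
      by (subst N.nn_integral_fst[symmetric]) (auto simp: norm_mult mult.commute)
    then show "(\<integral>\<^sup>+z. ennreal (norm (case z of (p, x) \<Rightarrow> f x * cnj (\<Psi> p x))) \<partial>(M \<Otimes>\<^sub>M N)) < \<infinity>"
      using fin1 by simp
  qed measurable
  have eq1: "(LINT p|M. (LINT x|N. f x * cnj (\<Psi> p x))) = (LINT x|N. f x * cnj (g x))"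
    using MN.Fubini_integral[OF int1] by (simp add: g_def)
  have int_fg: "integrable N (\<lambda>x. f x * cnj (g x))"
    using MN.integrable_snd[OF int1] by (simp add: g_def)
  have int2: "integrable ((M \<Otimes>\<^sub>M M) \<Otimes>\<^sub>M N) (case_prod h)"
  proof (rule integrableI_bounded)
    have "(\<integral>\<^sup>+z. ennreal (norm (case_prod h z)) \<partial>((M \<Otimes>\<^sub>M M) \<Otimes>\<^sub>M N))
      = (\<integral>\<^sup>+w. \<integral>\<^sup>+x. ennreal (norm (h w x)) \<partial>N \<partial>(M \<Otimes>\<^sub>M M))"
      by (subst N.nn_integral_fst[symmetric]) auto
    also have "\<dots> = (\<integral>\<^sup>+p. \<integral>\<^sup>+q. \<integral>\<^sup>+x. ennreal (norm (\<Psi> p x) * norm (\<Psi> q x)) \<partial>N \<partial>M \<partial>M)"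
      by (subst M.nn_integral_fst[symmetric]) (auto simp: h_def norm_mult)
    finally show "(\<integral>\<^sup>+z. ennreal (norm (case_prod h z)) \<partial>((M \<Otimes>\<^sub>M M) \<Otimes>\<^sub>M N)) < \<infinity>"
      using fin2 by simp
  qed measurable
  \<comment> \<open>The factorization into g x times its conjugate uses integrability in (p, q),
    which Fubini gives for almost every x.\<close>
  have gg: "AE x in N. (LINT w|(M \<Otimes>\<^sub>M M). h w x) = complex_of_real ((norm (g x))\<^sup>2)"
    using MMN.AE_integrable_snd[OF int2]
  proof eventually_elim
    case (elim x)
    have "(LINT w|(M \<Otimes>\<^sub>M M). h w x) = (LINT p|M. (LINT q|M. h (p, q) x))"
      using MM.integral_fst'[OF elim] by simp
    also have "\<dots> = g x * cnj (g x)" by (simp add: h_def g_def)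
    finally show ?case by (simp only: complex_norm_square)
  qed
  have g_meas [measurable]: "g \<in> borel_measurable N"
    unfolding g_def[abs_def] by measurable
  have "integrable N (\<lambda>x. complex_of_real ((norm (g x))\<^sup>2))"
    using MMN.integrable_snd[OF int2] by (rule integrable_cong_AE_imp) (use gg in auto)
  then have int_g: "integrable N (\<lambda>x. (norm (g x))\<^sup>2)"
    by (rule Bochner_Integration.integrable_bound) (auto simp: norm_power)
  have "complex_of_real (LINT x|N. (norm (g x))\<^sup>2) = (LINT x|N. complex_of_real ((norm (g x))\<^sup>2))"
    by (simp only: integral_complex_of_real)
  also have "\<dots> = (LINT x|N. (LINT w|(M \<Otimes>\<^sub>M M). h w x))"
    by (rule integral_cong_AE) (use gg in auto)
  also have "\<dots> = (LINT w|(M \<Otimes>\<^sub>M M). (LINT x|N. h w x))"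
    by (rule MMN.Fubini_integral[OF int2])
  finally have geq: "complex_of_real (LINT x|N. (norm (g x))\<^sup>2) = (LINT w|(M \<Otimes>\<^sub>M M). (LINT x|N. h w x))" .
  have "ennreal (LINT x|N. (norm (g x))\<^sup>2) = ennreal (norm (complex_of_real (LINT x|N. (norm (g x))\<^sup>2)))"
    by (simp add: integral_nonneg_AE)
  also have "\<dots> \<le> (\<integral>\<^sup>+w. ennreal (norm (LINT x|N. h w x)) \<partial>(M \<Otimes>\<^sub>M M))"
    unfolding geq by (rule integral_norm_bound_ennreal[OF MMN.integrable_fst[OF int2]])
  also have "\<dots> = (\<integral>\<^sup>+p. \<integral>\<^sup>+q. ennreal (norm (LINT x|N. \<Psi> p x * cnj (\<Psi> q x))) \<partial>M \<partial>M)"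
    by (subst M.nn_integral_fst[symmetric]) (auto simp: h_def[abs_def])
  finally have gb: "ennreal (LINT x|N. (norm (g x))\<^sup>2)
    \<le> (\<integral>\<^sup>+p. \<integral>\<^sup>+q. ennreal (norm (LINT x|N. \<Psi> p x * cnj (\<Psi> q x))) \<partial>M \<partial>M)" .
  have pt: "2 * l * Re (z * cnj w) \<le> l\<^sup>2 * (norm z)\<^sup>2 + (norm w)\<^sup>2" for z w :: complex
  proof -
    have "Re (z * cnj w) \<le> norm z * norm w"
      using complex_Re_le_cmod[of "z * cnj w"] by (simp add: norm_mult)
    then have "2 * l * Re (z * cnj w) \<le> 2 * l * (norm z * norm w)"
      using l by simp
    also have "\<dots> \<le> l\<^sup>2 * (norm z)\<^sup>2 + (norm w)\<^sup>2"
      using zero_le_power2[of "l * norm z - norm w"] by (simp add: power2_eq_square algebra_simps)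
    finally show ?thesis .
  qed
  have "2 * l * Re (LINT p|M. (LINT x|N. f x * cnj (\<Psi> p x))) = (LINT x|N. 2 * l * Re (f x * cnj (g x)))"
    unfolding eq1 using int_fg by (simp only: integral_mult_right_zero integral_Re)
  also have "\<dots> \<le> (LINT x|N. l\<^sup>2 * (norm (f x))\<^sup>2 + (norm (g x))\<^sup>2)"
  proof (rule integral_mono)
    show "integrable N (\<lambda>x. 2 * l * Re (f x * cnj (g x)))"
      using int_fg by (intro integrable_mult_right integrable_Re)
  qed (use f2 int_g pt in auto)
  also have "\<dots> = l\<^sup>2 * (LINT x|N. (norm (f x))\<^sup>2) + (LINT x|N. (norm (g x))\<^sup>2)"
    using f2 int_g by simp
  finally have "ennreal (2 * l * Re (LINT p|M. (LINT x|N. f x * cnj (\<Psi> p x))))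
    \<le> ennreal (l\<^sup>2 * (LINT x|N. (norm (f x))\<^sup>2) + (LINT x|N. (norm (g x))\<^sup>2))"
    by (rule ennreal_leI)
  also have "\<dots> = ennreal (l\<^sup>2 * (LINT x|N. (norm (f x))\<^sup>2)) + ennreal (LINT x|N. (norm (g x))\<^sup>2)"
    by (intro ennreal_plus) (auto intro!: integral_nonneg_AE)
  finally show ?thesis using gb by (meson add_left_mono order_trans)
qed

section \<open>Wave packets\<close>

text \<open>An integrable profile that is submultiplicative up to a factor 2. Windows are bounded by
  its cube because three factors are spent later: one on the x integral of a product of packets, one
  on the integral over positions, and one on the tail between far scales.\<close>

definition decay :: "real \<Rightarrow> real" where
  "decay u = 1 / (1 + u\<^sup>2)"

lemma decay_pos: "0 < decay u" and decay_le_1: "decay u \<le> 1" and decay_minus [simp]: "decay (- u) = decay u"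
  by (simp_all add: decay_def add_pos_nonneg)

lemma decay_nonneg [simp]: "0 \<le> decay u"
  using decay_pos[of u] by simp

lemma decay_measurable [measurable]: "decay \<in> borel_measurable borel"
  unfolding decay_def[abs_def] by measurable

lemma decay_antimono: "\<bar>u\<bar> \<le> \<bar>v\<bar> \<Longrightarrow> decay v \<le> decay u"
  unfolding decay_def using abs_le_square_iff[of u v] by (intro divide_left_mono) (auto intro!: mult_pos_pos add_pos_nonneg)

text \<open>A form of Peetre's inequality, from (a + b)^2 <= 2 a^2 + 2 b^2. It converts the product
  of bumps at y and y' into decay in y - y', uniformly in x.\<close>

lemma decay_mult_le: "decay a * decay b \<le> 2 * decay (a + b)"
proof -
  have "1 + (a + b)\<^sup>2 \<le> 2 * ((1 + a\<^sup>2) * (1 + b\<^sup>2))"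
    using zero_le_power2[of "a - b"] mult_nonneg_nonneg[of "a\<^sup>2" "b\<^sup>2"]
    by (simp add: power2_eq_square algebra_simps)
  then show ?thesis
    by (simp add: decay_def divide_simps add_pos_nonneg add_nonneg_eq_0_iff)
qed

lemma nn_integral_decay: "(\<integral>\<^sup>+x. ennreal (decay x) \<partial>lborel) = ennreal pi"
proof -
  have "integrable lborel decay" "(LBINT x. decay x) = pi"
    using integrable_inverse_1_plus_square LBINT_inverse_1_plus_square
    by (simp_all add: set_integrable_def interval_lebesgue_integral_def set_lebesgue_integral_def
        decay_def[abs_def] inverse_eq_divide)
  then show ?thesis by (subst nn_integral_eq_integral) auto
qed

lemma nn_integral_decay_affine:
  assumes "t > 0"
  shows "(\<integral>\<^sup>+x. ennreal (decay ((y - x) / t)) \<partial>lborel) = ennreal (pi * t)"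
proof -
  have "(\<integral>\<^sup>+x. ennreal (decay ((y - x) / t)) \<partial>lborel)
    = ennreal \<bar>- t\<bar> * (\<integral>\<^sup>+u. ennreal (decay ((y - (y + (- t) * u)) / t)) \<partial>lborel)"
    using assms by (intro nn_integral_real_affine) auto
  also have "\<dots> = ennreal t * ennreal pi"
    using assms by (simp add: nn_integral_decay)
  finally show ?thesis using assms by (simp add: ennreal_mult[symmetric] mult.commute)
qed

lemma nn_integral_decay_affine':
  assumes "t > 0"
  shows "(\<integral>\<^sup>+x. ennreal (decay ((x - y) / t)) \<partial>lborel) = ennreal (pi * t)"
proof -
  have "decay ((x - y) / t) = decay ((y - x) / t)" for x
    using decay_minus[of "(y - x) / t"] by (simp add: minus_divide_left)
  then show ?thesis using nn_integral_decay_affine[OF assms, of y] by simp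
qed

text \<open>The estimates use the Schwartz and support hypotheses through these consequences.
  \<open>\<delta>\<close> is some radius beyond which the transform vanishes, not necessarily the
  smallest one.\<close>

locale band_limited_window =
  fixes \<phi> :: "real \<Rightarrow> complex" and K \<delta> :: real
  assumes continuous: "continuous_on UNIV \<phi>"
    and K_pos: "K > 0" and \<delta>_pos: "\<delta> > 0"
    and window_decay: "norm (\<phi> u) \<le> K * decay u ^ 3"
    and band_limit: "\<bar>\<xi>\<bar> \<ge> \<delta> \<Longrightarrow> (LBINT x. iexp (- (\<xi> * x)) * \<phi> x) = 0"
begin

lemma \<phi>_measurable [measurable]: "\<phi> \<in> borel_measurable borel"
  using continuous by (rule borel_measurable_continuous_onI)

lemma wave_packet_measurable [measurable]:
  "(\<lambda>(p, x). wave_packet \<phi> p x) \<in> borel_measurable ((borel :: (real \<times> real \<times> real) measure) \<Otimes>\<^sub>M borel)"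
  unfolding wave_packet_def case_prod_unfold
  by (simp only: borel_prod[symmetric]) measurable

lemma wave_packet_continuous: "continuous_on UNIV (wave_packet \<phi> p)"
proof -
  obtain y \<eta> t where p: "p = (y, \<eta>, t)" by (cases p)
  show ?thesis
    unfolding p wave_packet_def split divide_inverse
    by (intro continuous_intros continuous_on_compose2[OF continuous]) auto
qed

lemma wave_packet_measurable' [measurable]: "wave_packet \<phi> p \<in> borel_measurable borel"
  using wave_packet_continuous by (rule borel_measurable_continuous_onI)

lemma wave_packet_bound:
  assumes t: "t > 0"
  shows "norm (wave_packet \<phi> (y, \<eta>, t) x) \<le> K / t * decay ((y - x) / t) ^ 3"
proof -
  have "norm (exp (- (\<i> * complex_of_real r))) = 1" for r
    using norm_exp_i_times[of "- r"] by simp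
  then have "norm (wave_packet \<phi> (y, \<eta>, t) x) = 1 / t * norm (\<phi> ((y - x) / t))"
    using t by (simp only: wave_packet_def split norm_mult complex_mod_cnj norm_of_real) simp
  also have "\<dots> \<le> 1 / t * (K * decay ((y - x) / t) ^ 3)"
    using t by (intro mult_left_mono window_decay) auto
  finally show ?thesis by simp
qed

lemma wave_packet_bound':
  assumes "t > 0"
  shows "norm (wave_packet \<phi> (y, \<eta>, t) x) \<le> K / t * decay ((y - x) / t)"
proof -
  have "decay ((y - x) / t) ^ 3 \<le> decay ((y - x) / t)"
    by (rule power_decreasing[of 1 3, simplified]) (auto simp: decay_le_1)
  then have "K / t * decay ((y - x) / t) ^ 3 \<le> K / t * decay ((y - x) / t)"
    using K_pos assms by (intro mult_left_mono) auto
  with wave_packet_bound[OF assms] show ?thesis by (rule order_trans)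
qed

lemma wave_packet_integrable:
  assumes "t > 0"
  shows "integrable lborel (wave_packet \<phi> (y, \<eta>, t))"
proof (rule Bochner_Integration.integrable_bound)
  show "integrable lborel (\<lambda>x. K / t * decay ((y - x) / t))"
    using assms nn_integral_decay_affine[OF assms, of y]
    by (intro integrable_mult_right integrableI_bounded) auto
  show "AE x in lborel. norm (wave_packet \<phi> (y, \<eta>, t) x) \<le> norm (K / t * decay ((y - x) / t))"
    by (intro AE_I2 order_trans[OF wave_packet_bound'[OF assms]]) (simp only: real_norm_def abs_ge_self)
qed measurable

text \<open>The narrower bump is widened to scale t to extract decay in y - y', while one of its
  factors is kept at scale t' for the x integral; the mass \<open>pi * t'\<close> of that factor
  cancels the normalization 1 / t'.\<close>

lemma abs_inner_bound:
  assumes t': "0 < t'" and le: "t' \<le> t"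
  shows "(\<integral>\<^sup>+x. ennreal (norm (wave_packet \<phi> (y, \<eta>, t) x) * norm (wave_packet \<phi> (y', \<eta>', t') x)) \<partial>lborel)
    \<le> ennreal (4 * pi * K\<^sup>2 / t * (decay ((y - y') / t))\<^sup>2)"
proof -
  have t: "0 < t" using t' le by simp
  define D where "D = decay ((y - y') / t)"
  have D: "0 \<le> D" by (simp add: D_def)
  have pt: "norm (wave_packet \<phi> (y, \<eta>, t) x) * norm (wave_packet \<phi> (y', \<eta>', t') x)
     \<le> 4 * K\<^sup>2 / (t * t') * D\<^sup>2 * decay ((y' - x) / t')" for x
  proof -
    define a b c where "a = decay ((y - x) / t)" and "b = decay ((y' - x) / t)" and "c = decay ((y' - x) / t')"
    have nn: "0 \<le> a" "0 \<le> b" "0 \<le> c" by (simp_all add: a_def b_def c_def)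
    have "b = decay ((x - y') / t)"
      unfolding b_def using decay_minus[of "(y' - x) / t"] by (simp add: minus_divide_left)
    then have "a * b \<le> 2 * D"
      using decay_mult_le[of "(y - x) / t" "(x - y') / t"]
      by (simp add: a_def D_def add_divide_distrib[symmetric])
    moreover have "c \<le> b"
      unfolding b_def c_def using le t t' by (intro decay_antimono) (auto simp: divide_left_mono)
    ultimately have ac: "a * c \<le> 2 * D"
      using mult_left_mono[of c b a] nn by linarith
    have "a \<le> 1" unfolding a_def by (rule decay_le_1)
    \<comment> \<open>Of the three factors a * c, two become (2 D)^2; in the third, a is bounded by
      1 and c is left to be integrated.\<close>
    have "a ^ 3 * c ^ 3 = (a * c)\<^sup>2 * (a * c)" by (simp add: power2_eq_square power3_eq_cube)
    also have "\<dots> \<le> (2 * D)\<^sup>2 * (1 * c)"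
      using power_mono[OF ac, of 2] nn \<open>a \<le> 1\<close> by (intro mult_mono[of "(a * c)\<^sup>2"]) (auto intro: mult_left_le_one_le)
    finally have acc: "a ^ 3 * c ^ 3 \<le> 4 * D\<^sup>2 * c" by (simp add: power_mult_distrib)
    have "norm (wave_packet \<phi> (y, \<eta>, t) x) * norm (wave_packet \<phi> (y', \<eta>', t') x) \<le> (K / t * a ^ 3) * (K / t' * c ^ 3)"
      unfolding a_def c_def by (intro mult_mono wave_packet_bound t t') (use K_pos t in auto)
    also have "\<dots> = K\<^sup>2 / (t * t') * (a ^ 3 * c ^ 3)" by (simp add: power2_eq_square)
    also have "\<dots> \<le> K\<^sup>2 / (t * t') * (4 * D\<^sup>2 * c)"
      using acc t t' by (intro mult_left_mono) auto
    finally show ?thesis by (simp add: c_def mult_ac)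
  qed
  have "(\<integral>\<^sup>+x. ennreal (norm (wave_packet \<phi> (y, \<eta>, t) x) * norm (wave_packet \<phi> (y', \<eta>', t') x)) \<partial>lborel)
    \<le> (\<integral>\<^sup>+x. ennreal (4 * K\<^sup>2 / (t * t') * D\<^sup>2) * ennreal (decay ((y' - x) / t')) \<partial>lborel)"
    using pt t t' by (intro nn_integral_mono) (simp add: ennreal_mult[symmetric])
  also have "\<dots> = ennreal (4 * K\<^sup>2 / (t * t') * D\<^sup>2 * (pi * t'))"
    using t t' by (subst nn_integral_cmult) (simp_all add: nn_integral_decay_affine ennreal_mult[symmetric])
  also have "4 * K\<^sup>2 / (t * t') * D\<^sup>2 * (pi * t') = 4 * pi * K\<^sup>2 / t * D\<^sup>2"
    using t t' by (simp add: field_simps)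
  finally show ?thesis by (simp add: D_def)
qed

text \<open>By x = y - t u. The packet therefore lives at frequencies within \<delta> / t of \<eta>;
  the conjugate is inherited from the one in the definition of the packet.\<close>

lemma fourier_wave_packet:
  assumes t: "t > 0"
  shows "(LBINT x. iexp (- (\<xi> * x)) * wave_packet \<phi> (y, \<eta>, t) x)
    = iexp (- (\<xi> * y)) * cnj (LBINT u. iexp (- ((t * (\<xi> - \<eta>)) * u)) * \<phi> u)"
proof -
  have "(LBINT x. iexp (- (\<xi> * x)) * wave_packet \<phi> (y, \<eta>, t) x)
    = \<bar>- t\<bar> *\<^sub>R (LBINT u. iexp (- (\<xi> * (y + (- t) * u))) * wave_packet \<phi> (y, \<eta>, t) (y + (- t) * u))"
    using t by (intro lborel_integral_real_affine) auto
  also have "(\<lambda>u. iexp (- (\<xi> * (y + (- t) * u))) * wave_packet \<phi> (y, \<eta>, t) (y + (- t) * u))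
    = (\<lambda>u. complex_of_real (1 / t) * (iexp (- (\<xi> * y)) * cnj (iexp (- ((t * (\<xi> - \<eta>)) * u)) * \<phi> u)))"
    using t by (intro ext) (simp add: wave_packet_def exp_cnj exp_add[symmetric] algebra_simps mult_exp_exp)
  also have "\<bar>- t\<bar> *\<^sub>R (LBINT u. complex_of_real (1 / t) * (iexp (- (\<xi> * y)) * cnj (iexp (- ((t * (\<xi> - \<eta>)) * u)) * \<phi> u)))
    = iexp (- (\<xi> * y)) * cnj (LBINT u. iexp (- ((t * (\<xi> - \<eta>)) * u)) * \<phi> u)"
    unfolding integral_mult_right_zero Bochner_Integration.integral_cnj
    using t by (simp add: scaleR_conv_of_real)
  finally show ?thesis .
qed

lemma wave_packets_orthogonal:
  assumes t: "t > 0" and t': "t' > 0" and sep: "\<delta> * (1 / t + 1 / t') \<le> \<bar>\<eta> - \<eta>'\<bar>"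
  shows "(LBINT x. wave_packet \<phi> (y, \<eta>, t) x * cnj (wave_packet \<phi> (y', \<eta>', t') x)) = 0"
proof (rule fourier_disjoint_orthogonal)
  show "norm (wave_packet \<phi> (y', \<eta>', t') x) \<le> K / t' * 1" for x
    using K_pos t' by (intro order_trans[OF wave_packet_bound'[OF t']] mult_left_mono) (auto simp: decay_le_1)
  fix \<xi>
  have "\<delta> / t \<le> \<bar>\<xi> - \<eta>\<bar> \<or> \<delta> / t' \<le> \<bar>\<xi> - \<eta>'\<bar>"
    using sep by (simp add: distrib_left) arith
  then have "\<delta> \<le> \<bar>t * (\<xi> - \<eta>)\<bar> \<or> \<delta> \<le> \<bar>t' * (\<xi> - \<eta>')\<bar>"
    using t t' by (auto simp: abs_mult divide_simps mult.commute)
  then show "(LBINT x. iexp (- (\<xi> * x)) * wave_packet \<phi> (y, \<eta>, t) x) = 0 \<or>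
         (LBINT x. iexp (- (\<xi> * x)) * wave_packet \<phi> (y', \<eta>', t') x) = 0"
    using band_limit unfolding fourier_wave_packet[OF t] fourier_wave_packet[OF t'] by fastforce
qed (use t t' in \<open>auto intro: wave_packet_integrable wave_packet_continuous\<close>)

definition kernel :: "real \<times> real \<times> real \<Rightarrow> real \<times> real \<times> real \<Rightarrow> real" where
  "kernel p q = norm (LBINT x. wave_packet \<phi> p x * cnj (wave_packet \<phi> q x))"

lemma kernel_nonneg [simp]: "0 \<le> kernel p q"
  by (simp add: kernel_def)

lemma kernel_commute: "kernel p q = kernel q p"
proof -
  have "kernel p q = norm (cnj (LBINT x. wave_packet \<phi> p x * cnj (wave_packet \<phi> q x)))"
    by (simp only: kernel_def complex_mod_cnj)
  also have "\<dots> = kernel q p"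
    unfolding kernel_def Bochner_Integration.integral_cnj[symmetric] by (simp add: mult.commute)
  finally show ?thesis .
qed

lemma kernel_measurable [measurable]:
  "(\<lambda>(p, q). kernel p q) \<in> borel_measurable (borel \<Otimes>\<^sub>M borel)"
  unfolding kernel_def[abs_def] by measurable

text \<open>The size comes from \<open>abs_inner_bound\<close> and the indicator from orthogonality:
  since t' <= t, the sum \<delta> / t + \<delta> / t' of the frequency radii is at most 2 \<delta> /
  t'. A cutoff expressed by the smaller scale alone is the form in which separation can be
  applied.\<close>

lemma kernel_bound:
  assumes t': "0 < t'" and le: "t' \<le> t"
  shows "kernel (y, \<eta>, t) (y', \<eta>', t')
    \<le> 4 * pi * K\<^sup>2 / t * (decay ((y - y') / t))\<^sup>2 * indicator {\<omega>. \<bar>\<eta> - \<omega>\<bar> < 2 * \<delta> / t'} \<eta>'"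
proof (cases "\<bar>\<eta> - \<eta>'\<bar> < 2 * \<delta> / t'")
  case True
  have t: "0 < t" using t' le by simp
  have i: "integrable lborel (\<lambda>x. wave_packet \<phi> (y, \<eta>, t) x * cnj (wave_packet \<phi> (y', \<eta>', t') x))"
    using abs_inner_bound[OF t' le, of y \<eta> y' \<eta>']
    by (intro integrableI_bounded) (auto simp: norm_mult intro: le_less_trans)
  have "ennreal (kernel (y, \<eta>, t) (y', \<eta>', t')) \<le> ennreal (4 * pi * K\<^sup>2 / t * (decay ((y - y') / t))\<^sup>2)"
    using integral_norm_bound_ennreal[OF i] abs_inner_bound[OF t' le, of y \<eta> y' \<eta>']
    by (simp add: kernel_def norm_mult)
  then show ?thesis using True t by (simp add: ennreal_le_iff)
next
  case False
  have "\<delta> * (1 / t + 1 / t') \<le> 2 * \<delta> / t'"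
    using le t' \<delta>_pos by (simp add: divide_simps)
  then have "kernel (y, \<eta>, t) (y', \<eta>', t') = 0"
    unfolding kernel_def using wave_packets_orthogonal[of t t' \<eta> \<eta>' y y'] False t' le by simp
  then show ?thesis using t' le by simp
qed

end

section \<open>Schur estimates on separated sets\<close>

lemma borel_measurable_fst_snd [measurable]:
  "fst \<in> (borel :: ('a::second_countable_topology \<times> 'b::second_countable_topology) measure) \<rightarrow>\<^sub>M borel"
  "snd \<in> (borel :: ('a \<times> 'b) measure) \<rightarrow>\<^sub>M borel"
  unfolding borel_prod[symmetric] by measurable

text \<open>Position outermost suits rows, where separation is applied over one fixed position;
  scale outermost suits tents and columns.\<close>

lemma nn_integral_lborel3:
  fixes f :: "real \<times> real \<times> real \<Rightarrow> ennreal"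
  assumes [measurable]: "f \<in> borel_measurable borel"
  shows "(\<integral>\<^sup>+p. f p \<partial>lborel) = (\<integral>\<^sup>+y. \<integral>\<^sup>+\<eta>. \<integral>\<^sup>+t. f (y, \<eta>, t) \<partial>lborel \<partial>lborel \<partial>lborel)"
    and "(\<integral>\<^sup>+p. f p \<partial>lborel) = (\<integral>\<^sup>+t. \<integral>\<^sup>+\<eta>. \<integral>\<^sup>+y. f (y, \<eta>, t) \<partial>lborel \<partial>lborel \<partial>lborel)"
proof -
  have f [measurable]: "f \<in> borel_measurable (lborel \<Otimes>\<^sub>M (lborel \<Otimes>\<^sub>M lborel))"
    by (simp add: lborel_prod)
  have sf: "sigma_finite_measure (lborel \<Otimes>\<^sub>M lborel :: (real \<times> real) measure)"
    unfolding lborel_prod by (rule sigma_finite_lborel)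
  interpret L3: pair_sigma_finite "lborel :: real measure" "lborel \<Otimes>\<^sub>M lborel :: (real \<times> real) measure"
    using sf sigma_finite_lborel by (simp add: pair_sigma_finite_def)
  have "(\<integral>\<^sup>+p. f p \<partial>lborel) = (\<integral>\<^sup>+p. f p \<partial>(lborel \<Otimes>\<^sub>M (lborel \<Otimes>\<^sub>M lborel)))"
    by (simp add: lborel_prod)
  also have "\<dots> = (\<integral>\<^sup>+y. \<integral>\<^sup>+w. f (y, w) \<partial>(lborel \<Otimes>\<^sub>M lborel) \<partial>lborel)"
    by (rule sigma_finite_measure.nn_integral_fst[OF sf, symmetric]) measurable
  also have "\<dots> = (\<integral>\<^sup>+y. \<integral>\<^sup>+\<eta>. \<integral>\<^sup>+t. f (y, \<eta>, t) \<partial>lborel \<partial>lborel \<partial>lborel)"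
    by (intro nn_integral_cong lborel.nn_integral_fst[symmetric]) measurable
  finally show "(\<integral>\<^sup>+p. f p \<partial>lborel) = (\<integral>\<^sup>+y. \<integral>\<^sup>+\<eta>. \<integral>\<^sup>+t. f (y, \<eta>, t) \<partial>lborel \<partial>lborel \<partial>lborel)" .
  have "(\<integral>\<^sup>+p. f p \<partial>lborel) = (\<integral>\<^sup>+p. f p \<partial>(lborel \<Otimes>\<^sub>M (lborel \<Otimes>\<^sub>M lborel)))"
    by (simp add: lborel_prod)
  also have "\<dots> = (\<integral>\<^sup>+w. \<integral>\<^sup>+y. f (y, w) \<partial>lborel \<partial>(lborel \<Otimes>\<^sub>M lborel))"
    by (rule L3.nn_integral_snd[symmetric]) measurable
  also have "\<dots> = (\<integral>\<^sup>+t. \<integral>\<^sup>+\<eta>. \<integral>\<^sup>+y. f (y, \<eta>, t) \<partial>lborel \<partial>lborel \<partial>lborel)"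
    by (rule lborel_pair.nn_integral_snd[symmetric]) measurable
  finally show "(\<integral>\<^sup>+p. f p \<partial>lborel) = (\<integral>\<^sup>+t. \<integral>\<^sup>+\<eta>. \<integral>\<^sup>+y. f (y, \<eta>, t) \<partial>lborel \<partial>lborel \<partial>lborel)" .
qed

lemma tent_borel [measurable]: "tent \<Theta> x \<xi> s \<in> sets borel"
proof -
  obtain C1 C2 b where \<Theta>: "\<Theta> = (C1, C2, b)" by (cases \<Theta>)
  have "{p \<in> space (borel \<Otimes>\<^sub>M (borel \<Otimes>\<^sub>M borel)). 0 < snd (snd p) \<and> snd (snd p) < s \<and> \<bar>fst p - x\<bar> < s - snd (snd p)
      \<and> - (C1 / snd (snd p)) < fst (snd p) - \<xi> \<and> fst (snd p) - \<xi> < C2 / snd (snd p)}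
    \<in> sets (borel \<Otimes>\<^sub>M (borel \<Otimes>\<^sub>M (borel :: real measure)))"
    by measurable
  then show ?thesis
    unfolding borel_prod by (simp add: \<Theta> tent_def case_prod_unfold)
qed

text \<open>At height t the frequency slice has length (C1 + C2) / t, and the position integral of
  the decay away from the two ends of the base is at most 2 pi t / c. The powers of t cancel, so
  integrating over scales up to s leaves a multiple of s.\<close>

lemma nn_integral_tent_decay:
  assumes C: "0 < C1" "0 < C2" and c: "0 < c" and s: "0 < s"
  shows "(\<integral>\<^sup>+p. indicator (tent (C1, C2, b) x \<xi> s) p * ennreal (decay (c * (s - \<bar>fst p - x\<bar>) / snd (snd p))) \<partial>lborel)
    \<le> ennreal (2 * pi * (C1 + C2) / c * s)"
proof -
  have "(\<integral>\<^sup>+p. indicator (tent (C1, C2, b) x \<xi> s) p * ennreal (decay (c * (s - \<bar>fst p - x\<bar>) / snd (snd p))) \<partial>lborel)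
    = (\<integral>\<^sup>+t. \<integral>\<^sup>+\<eta>. \<integral>\<^sup>+y. indicator (tent (C1, C2, b) x \<xi> s) (y, \<eta>, t) * ennreal (decay (c * (s - \<bar>y - x\<bar>) / t)) \<partial>lborel \<partial>lborel \<partial>lborel)"
    by (subst nn_integral_lborel3(2)) auto
  also have "\<dots> \<le> (\<integral>\<^sup>+t. \<integral>\<^sup>+\<eta>. indicator {0<..s} t * (indicator {\<xi> - C1 / t .. \<xi> + C2 / t} \<eta> * ennreal (2 * pi * t / c)) \<partial>lborel \<partial>lborel)"
  proof (intro nn_integral_mono)
    fix t \<eta> :: real
    show "(\<integral>\<^sup>+y. indicator (tent (C1, C2, b) x \<xi> s) (y, \<eta>, t) * ennreal (decay (c * (s - \<bar>y - x\<bar>) / t)) \<partial>lborel)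
      \<le> indicator {0<..s} t * (indicator {\<xi> - C1 / t .. \<xi> + C2 / t} \<eta> * ennreal (2 * pi * t / c))"
    proof (cases "0 < t \<and> t \<le> s \<and> \<xi> - C1 / t \<le> \<eta> \<and> \<eta> \<le> \<xi> + C2 / t")
      case True
      have "(\<integral>\<^sup>+y. indicator (tent (C1, C2, b) x \<xi> s) (y, \<eta>, t) * ennreal (decay (c * (s - \<bar>y - x\<bar>) / t)) \<partial>lborel)
        \<le> (\<integral>\<^sup>+y. ennreal (decay ((s + x - y) / (t / c))) + ennreal (decay ((y - (x - s)) / (t / c))) \<partial>lborel)"
      proof (intro nn_integral_mono)
        fix y
        \<comment> \<open>s - |y - x| is the distance to the nearer end of the base; the sum of the
          decays from both ends x + s and x - s covers either case.\<close>
        have "decay (c * (s - \<bar>y - x\<bar>) / t) \<le> decay ((s + x - y) / (t / c)) + decay ((y - (x - s)) / (t / c))"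
        proof (cases "y \<ge> x")
          case True
          then have "decay (c * (s - \<bar>y - x\<bar>) / t) = decay ((s + x - y) / (t / c))" by (simp add: mult.commute algebra_simps)
          then show ?thesis by simp
        next
          case False
          then have "decay (c * (s - \<bar>y - x\<bar>) / t) = decay ((y - (x - s)) / (t / c))" by (simp add: mult.commute algebra_simps)
          then show ?thesis by simp
        qed
        then show "indicator (tent (C1, C2, b) x \<xi> s) (y, \<eta>, t) * ennreal (decay (c * (s - \<bar>y - x\<bar>) / t))
          \<le> ennreal (decay ((s + x - y) / (t / c))) + ennreal (decay ((y - (x - s)) / (t / c)))"
          by (auto simp: indicator_def ennreal_plus[symmetric] simp del: ennreal_plus)
      qed
      also have "\<dots> = ennreal (pi * (t / c)) + ennreal (pi * (t / c))"
        using True c by (subst nn_integral_add, simp, simp, subst nn_integral_decay_affine, simp, subst nn_integral_decay_affine') simp_all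
      also have "\<dots> = ennreal (2 * pi * t / c)"
        using True c by (simp add: ennreal_plus[symmetric] del: ennreal_plus)
      finally show ?thesis using True by simp
    next
      case False
      then have "(y, \<eta>, t) \<notin> tent (C1, C2, b) x \<xi> s" for y by (auto simp: tent_def)
      then show ?thesis by simp
    qed
  qed
  also have "\<dots> = (\<integral>\<^sup>+t. indicator {0<..s} t * (ennreal ((C1 + C2) / t) * ennreal (2 * pi * t / c)) \<partial>lborel)"
  proof (intro nn_integral_cong)
    fix t :: real
    show "(\<integral>\<^sup>+\<eta>. indicator {0<..s} t * (indicator {\<xi> - C1 / t .. \<xi> + C2 / t} \<eta> * ennreal (2 * pi * t / c)) \<partial>lborel)
      = indicator {0<..s} t * (ennreal ((C1 + C2) / t) * ennreal (2 * pi * t / c))"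
    proof (cases "0 < t")
      case True
      then have "\<xi> - C1 / t \<le> \<xi> + C2 / t" using C by (simp add: divide_pos_pos[THEN less_imp_le] add_increasing2 order_trans[of _ \<xi>])
      then show ?thesis using True
        by (subst nn_integral_cmult, simp, subst nn_integral_multc) (simp_all add: add_divide_distrib add.commute)
    qed simp
  qed
  also have "\<dots> = (\<integral>\<^sup>+t. ennreal (2 * pi * (C1 + C2) / c) * indicator {0<..s} t \<partial>lborel)"
    using C c by (intro nn_integral_cong) (auto simp: indicator_def ennreal_mult[symmetric] field_simps)
  also have "\<dots> = ennreal (2 * pi * (C1 + C2) / c * s)"
    using C c s by (simp add: nn_integral_cmult ennreal_mult[symmetric])
  finally show ?thesis .
qed

text \<open>\<open>slice\<close> is the form of separation used for rows: over one position y,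
  points of P whose frequency windows share some \<eta> have scales within a factor B of each other,
  as the two points may be exchanged.\<close>

locale separated_set = band_limited_window +
  fixes B :: real and P :: "(real \<times> real \<times> real) set"
  assumes B: "1 < B" and P_borel [measurable]: "P \<in> sets borel"
    and P_pos: "(y, \<eta>, t) \<in> P \<Longrightarrow> 0 < t"
    and slice: "\<lbrakk>(y, \<eta>1, t1) \<in> P; (y, \<eta>2, t2) \<in> P; \<bar>\<eta> - \<eta>1\<bar> < 2 * \<delta> / t1; \<bar>\<eta> - \<eta>2\<bar> < 2 * \<delta> / t2\<rbrakk> \<Longrightarrow> t2 \<le> B * t1"
begin

text \<open>The product of 4 pi K^2 from the kernel bound, pi from the position integral and 4
  \<delta> B^2 from \<open>slice_integral\<close>.\<close>

definition schur_const :: real where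
  "schur_const = 16 * pi\<^sup>2 * K\<^sup>2 * \<delta> * B\<^sup>2"

lemma schur_const_pos: "0 < schur_const"
  using K_pos \<delta>_pos B by (simp add: schur_const_def)

text \<open>If one point (y, \<eta>1, t1) contributes, all contributing scales lie between t1 / B and B t1, which
  confines the integration to a box of volume independent of t1.\<close>

lemma slice_integral:
  "(\<integral>\<^sup>+\<eta>'. \<integral>\<^sup>+t'. indicator P (y, \<eta>', t') * indicator {\<omega>. \<bar>\<eta> - \<omega>\<bar> < 2 * \<delta> / t'} \<eta>' \<partial>lborel \<partial>lborel)
    \<le> ennreal (4 * \<delta> * B\<^sup>2)"
proof (cases "\<exists>\<eta>1 t1. (y, \<eta>1, t1) \<in> P \<and> \<bar>\<eta> - \<eta>1\<bar> < 2 * \<delta> / t1")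
  case True
  then obtain \<eta>1 t1 where 1: "(y, \<eta>1, t1) \<in> P" "\<bar>\<eta> - \<eta>1\<bar> < 2 * \<delta> / t1" by auto
  note t1 = P_pos[OF 1(1)]
  define r where "r = 2 * \<delta> * B / t1"
  have r: "0 < r" using \<delta>_pos B t1 by (simp add: r_def)
  have "(\<integral>\<^sup>+\<eta>'. \<integral>\<^sup>+t'. indicator P (y, \<eta>', t') * indicator {\<omega>. \<bar>\<eta> - \<omega>\<bar> < 2 * \<delta> / t'} \<eta>' \<partial>lborel \<partial>lborel)
    \<le> (\<integral>\<^sup>+\<eta>'. \<integral>\<^sup>+t'. indicator {\<eta> - r .. \<eta> + r} \<eta>' * indicator {0 .. B * t1} t' \<partial>lborel \<partial>lborel)"
  proof (intro nn_integral_mono)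
    fix \<eta>' t'
    show "(indicator P (y, \<eta>', t') * indicator {\<omega>. \<bar>\<eta> - \<omega>\<bar> < 2 * \<delta> / t'} \<eta>' :: ennreal)
      \<le> indicator {\<eta> - r .. \<eta> + r} \<eta>' * indicator {0 .. B * t1} t'"
    proof (cases "(y, \<eta>', t') \<in> P \<and> \<bar>\<eta> - \<eta>'\<bar> < 2 * \<delta> / t'")
      case True
      then have t': "0 < t'" "t' \<le> B * t1" "t1 \<le> B * t'"
        using P_pos slice[OF 1(1) _ 1(2)] slice[OF _ 1(1) _ 1(2)] by auto
      have "2 * \<delta> / t' \<le> r"
        using t' t1 \<delta>_pos by (simp add: r_def divide_simps)
      then show ?thesis using True t' by (auto simp: indicator_def)
    qed (auto simp: indicator_def)
  qed
  also have "\<dots> = ennreal (2 * r) * ennreal (B * t1)"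
    using r B t1 by (simp add: nn_integral_cmult nn_integral_multc)
  also have "\<dots> = ennreal (4 * \<delta> * B\<^sup>2)"
    using r B t1 \<delta>_pos by (simp add: ennreal_mult[symmetric]) (simp add: r_def power2_eq_square)
  finally show ?thesis .
next
  case False
  then have "(indicator P (y, \<eta>', t') * indicator {\<omega>. \<bar>\<eta> - \<omega>\<bar> < 2 * \<delta> / t'} \<eta>' :: ennreal) = 0" for \<eta>' t'
    by (auto simp: indicator_def)
  then show ?thesis by (simp only: nn_integral_const mult_zero_left zero_le)
qed

text \<open>The squared decay of the kernel bound is split: one factor is frozen at the distance
  \<rho>, the other is integrated in y', and over each y' frequency and scale contribute at most the
  volume from \<open>slice_integral\<close>. \<open>tail\<close> speaks of close frequencies because
  every other q is orthogonal to p. The choice \<rho> = 0 gives the plain row bound.\<close>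

lemma schur_row:
  assumes t: "0 < t" and R [measurable]: "R \<in> sets borel" and RP: "R \<subseteq> P" and \<rho>: "0 \<le> \<rho>"
    and le: "\<And>y' \<eta>' t'. (y', \<eta>', t') \<in> R \<Longrightarrow> t' \<le> t"
    and tail: "\<And>y' \<eta>' t'. (y', \<eta>', t') \<in> R \<Longrightarrow> \<bar>\<eta> - \<eta>'\<bar> < 2 * \<delta> / t' \<Longrightarrow> \<rho> \<le> \<bar>y - y'\<bar>"
  shows "(\<integral>\<^sup>+q. indicator R q * ennreal (kernel (y, \<eta>, t) q) \<partial>lborel) \<le> ennreal (schur_const * decay (\<rho> / t))"
proof -
  define A where "A = 4 * pi * K\<^sup>2 / t * decay (\<rho> / t)"
  have A: "0 \<le> A" using t by (simp add: A_def)
  have pt: "indicator R (y', \<eta>', t') * ennreal (kernel (y, \<eta>, t) (y', \<eta>', t'))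
    \<le> ennreal (A * decay ((y - y') / t)) * (indicator P (y', \<eta>', t') * indicator {\<omega>. \<bar>\<eta> - \<omega>\<bar> < 2 * \<delta> / t'} \<eta>')" for y' \<eta>' t'
  proof (cases "(y', \<eta>', t') \<in> R")
    case True
    then have P: "(y', \<eta>', t') \<in> P" using RP by auto
    note kb = kernel_bound[OF P_pos[OF P] le[OF True], of y \<eta> y' \<eta>']
    show ?thesis
    proof (cases "\<bar>\<eta> - \<eta>'\<bar> < 2 * \<delta> / t'")
      case near: True
      have "decay ((y - y') / t) \<le> decay (\<rho> / t)"
        using tail[OF True near] \<rho> t by (intro decay_antimono) (simp add: divide_right_mono)
      then have "(decay ((y - y') / t))\<^sup>2 \<le> decay (\<rho> / t) * decay ((y - y') / t)"
        by (simp add: power2_eq_square mult_right_mono)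
      then have "4 * pi * K\<^sup>2 / t * (decay ((y - y') / t))\<^sup>2 \<le> A * decay ((y - y') / t)"
        unfolding A_def mult.assoc using t by (intro mult_left_mono) auto
      with kb have "kernel (y, \<eta>, t) (y', \<eta>', t') \<le> A * decay ((y - y') / t)"
        using near by (simp only: indicator_def mem_Collect_eq of_bool_eq mult_1_right)
      then show ?thesis using True P near by (simp add: ennreal_leI)
    next
      case False
      then have "kernel (y, \<eta>, t) (y', \<eta>', t') = 0"
        using kb by (simp add: order_antisym)
      then show ?thesis by simp
    qed
  qed simp
  have "(\<integral>\<^sup>+q. indicator R q * ennreal (kernel (y, \<eta>, t) q) \<partial>lborel)
    = (\<integral>\<^sup>+y'. \<integral>\<^sup>+\<eta>'. \<integral>\<^sup>+t'. indicator R (y', \<eta>', t') * ennreal (kernel (y, \<eta>, t) (y', \<eta>', t')) \<partial>lborel \<partial>lborel \<partial>lborel)"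
    by (rule nn_integral_lborel3(1)) measurable
  also have "\<dots> \<le> (\<integral>\<^sup>+y'. \<integral>\<^sup>+\<eta>'. \<integral>\<^sup>+t'. ennreal (A * decay ((y - y') / t)) *
      (indicator P (y', \<eta>', t') * indicator {\<omega>. \<bar>\<eta> - \<omega>\<bar> < 2 * \<delta> / t'} \<eta>') \<partial>lborel \<partial>lborel \<partial>lborel)"
    by (intro nn_integral_mono pt)
  also have "\<dots> = (\<integral>\<^sup>+y'. ennreal (A * decay ((y - y') / t)) * (\<integral>\<^sup>+\<eta>'. \<integral>\<^sup>+t'.
      (indicator P (y', \<eta>', t') * indicator {\<omega>. \<bar>\<eta> - \<omega>\<bar> < 2 * \<delta> / t'} \<eta>') \<partial>lborel \<partial>lborel) \<partial>lborel)"
    by (simp add: nn_integral_cmult)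
  also have "\<dots> \<le> (\<integral>\<^sup>+y'. ennreal (A * decay ((y - y') / t)) * ennreal (4 * \<delta> * B\<^sup>2) \<partial>lborel)"
    by (intro nn_integral_mono mult_left_mono slice_integral) auto
  also have "\<dots> = ennreal (A * (pi * t) * (4 * \<delta> * B\<^sup>2))"
    using A \<delta>_pos t by (simp add: nn_integral_multc nn_integral_cmult ennreal_mult nn_integral_decay_affine)
  also have "A * (pi * t) * (4 * \<delta> * B\<^sup>2) = schur_const * decay (\<rho> / t)"
    using t by (simp add: A_def schur_const_def power2_eq_square)
  finally show ?thesis .
qed

text \<open>The scale interval has length (B - 1) t', the frequency window 4 \<delta> / t', and the
  position integral is at most a constant. The argument rests on the length of the scale interval,
  so it yields columns for comparable scales only.\<close>

lemma schur_column:
  assumes t': "0 < t'"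
  shows "(\<integral>\<^sup>+p. indicator {p. t' \<le> snd (snd p) \<and> snd (snd p) \<le> B * t'} p * ennreal (kernel p (y', \<eta>', t')) \<partial>lborel)
    \<le> ennreal schur_const"
proof -
  let ?N = "{p. t' \<le> snd (snd p) \<and> snd (snd p) \<le> B * t'} :: (real \<times> real \<times> real) set"
  define r where "r = 2 * \<delta> / t'"
  have r: "0 < r" using \<delta>_pos t' by (simp add: r_def)
  have [measurable]: "?N \<in> sets borel" 
    by (intro borel_closed closed_Collect_conj closed_Collect_le continuous_intros)
  have "(\<integral>\<^sup>+p. indicator ?N p * ennreal (kernel p (y', \<eta>', t')) \<partial>lborel)
    = (\<integral>\<^sup>+t. \<integral>\<^sup>+\<eta>. \<integral>\<^sup>+y. indicator ?N (y, \<eta>, t) * ennreal (kernel (y, \<eta>, t) (y', \<eta>', t')) \<partial>lborel \<partial>lborel \<partial>lborel)"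
    by (rule nn_integral_lborel3(2)) measurable
  also have "\<dots> \<le> (\<integral>\<^sup>+t. \<integral>\<^sup>+\<eta>. indicator {t'..B * t'} t * (indicator {\<eta>' - r .. \<eta>' + r} \<eta> * ennreal (4 * pi\<^sup>2 * K\<^sup>2)) \<partial>lborel \<partial>lborel)"
  proof (intro nn_integral_mono)
    fix t \<eta>
    show "(\<integral>\<^sup>+y. indicator ?N (y, \<eta>, t) * ennreal (kernel (y, \<eta>, t) (y', \<eta>', t')) \<partial>lborel)
      \<le> indicator {t'..B * t'} t * (indicator {\<eta>' - r .. \<eta>' + r} \<eta> * ennreal (4 * pi\<^sup>2 * K\<^sup>2))"
    proof (cases "t' \<le> t \<and> t \<le> B * t'")
      case True
      then have t: "0 < t" using t' by auto
      show ?thesis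
      proof (cases "\<bar>\<eta> - \<eta>'\<bar> < r")
        case near: True
        have "(\<integral>\<^sup>+y. indicator ?N (y, \<eta>, t) * ennreal (kernel (y, \<eta>, t) (y', \<eta>', t')) \<partial>lborel)
          \<le> (\<integral>\<^sup>+y. ennreal (4 * pi * K\<^sup>2 / t) * ennreal (decay ((y - y') / t)) \<partial>lborel)"
        proof (intro nn_integral_mono)
          fix y
          have "(decay ((y - y') / t))\<^sup>2 \<le> decay ((y - y') / t)"
            using power_decreasing[of 1 2 "decay ((y - y') / t)"] by (simp add: decay_le_1)
          then have "4 * pi * K\<^sup>2 / t * (decay ((y - y') / t))\<^sup>2 \<le> 4 * pi * K\<^sup>2 / t * decay ((y - y') / t)"
            using t by (intro mult_left_mono) auto
          with kernel_bound[OF t' conjunct1[OF True], of y \<eta> y' \<eta>']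
          have "kernel (y, \<eta>, t) (y', \<eta>', t') \<le> 4 * pi * K\<^sup>2 / t * decay ((y - y') / t)"
            using near by (simp add: r_def)
          then show "indicator ?N (y, \<eta>, t) * ennreal (kernel (y, \<eta>, t) (y', \<eta>', t'))
            \<le> ennreal (4 * pi * K\<^sup>2 / t) * ennreal (decay ((y - y') / t))"
            using t by (auto simp: indicator_def ennreal_mult[symmetric] intro!: ennreal_leI)
        qed
        also have "\<dots> = ennreal (4 * pi\<^sup>2 * K\<^sup>2)"
          using t by (subst nn_integral_cmult) (simp_all add: nn_integral_decay_affine' ennreal_mult[symmetric], simp add: power2_eq_square mult_ac)
        finally show ?thesis using True near by (simp add: abs_less_iff)
      next
        case False
        have "kernel (y, \<eta>, t) (y', \<eta>', t') = 0" for y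
          using kernel_bound[OF t' conjunct1[OF True], of y \<eta> y' \<eta>'] False by (simp add: r_def order_antisym)
        then show ?thesis by simp
      qed
    qed simp
  qed
  also have "\<dots> = ennreal (B * t' - t') * (ennreal (2 * r) * ennreal (4 * pi\<^sup>2 * K\<^sup>2))"
    using r t' B by (simp add: nn_integral_cmult nn_integral_multc)
  also have "\<dots> = ennreal ((B * t' - t') * (2 * r * (4 * pi\<^sup>2 * K\<^sup>2)))"
    using r t' B mult_right_mono[of 1 B t'] by (simp add: ennreal_mult[symmetric] mult_ac)
  also have "\<dots> \<le> ennreal schur_const"
  proof (rule ennreal_leI)
    have "(B * t' - t') * (2 * r * (4 * pi\<^sup>2 * K\<^sup>2)) = (B - 1) * (16 * pi\<^sup>2 * K\<^sup>2 * \<delta>)"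
      using t' by (simp add: r_def field_simps)
    also have "\<dots> \<le> B\<^sup>2 * (16 * pi\<^sup>2 * K\<^sup>2 * \<delta>)"
      using B \<delta>_pos mult_mono[of 1 B 1 B] by (intro mult_right_mono) (auto simp: power2_eq_square intro: order_trans[of _ "1 * B"])
    finally show "(B * t' - t') * (2 * r * (4 * pi\<^sup>2 * K\<^sup>2)) \<le> schur_const"
      by (simp add: schur_const_def mult_ac)
  qed
  finally show ?thesis .
qed

end

section \<open>Coefficients of f and the TT* inequality for them\<close>

context band_limited_window
begin

definition coeff :: "(real \<Rightarrow> complex) \<Rightarrow> real \<times> real \<times> real \<Rightarrow> complex" where
  "coeff f p = (LBINT x. f x * cnj (wave_packet \<phi> p x))"

lemma coeff_measurable [measurable]:
  assumes [measurable]: "f \<in> borel_measurable borel"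
  shows "coeff f \<in> borel_measurable borel"
  unfolding coeff_def[abs_def] by measurable

lemma abs_inner_le:
  assumes "0 < \<tau>" "\<tau> \<le> snd (snd p)" "\<tau> \<le> snd (snd q)"
  shows "(\<integral>\<^sup>+x. ennreal (norm (wave_packet \<phi> p x) * norm (wave_packet \<phi> q x)) \<partial>lborel) \<le> ennreal (4 * pi * K\<^sup>2 / \<tau>)"
proof -
  have bound: "(\<integral>\<^sup>+x. ennreal (norm (wave_packet \<phi> p x) * norm (wave_packet \<phi> q x)) \<partial>lborel) \<le> ennreal (4 * pi * K\<^sup>2 / \<tau>)"
    if "\<tau> \<le> snd (snd q)" "snd (snd q) \<le> snd (snd p)" for p q
  proof -
    obtain y \<eta> t y' \<eta>' t' where pq: "p = (y, \<eta>, t)" "q = (y', \<eta>', t')" by (cases p, cases q)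
    have t: "0 < t'" "t' \<le> t" "\<tau> \<le> t" using that assms(1) by (auto simp: pq)
    have "4 * pi * K\<^sup>2 / t * (decay ((y - y') / t))\<^sup>2 \<le> 4 * pi * K\<^sup>2 / \<tau> * 1"
      using t assms(1) by (intro mult_mono divide_left_mono) (auto simp: decay_le_1 power_le_one)
    then show ?thesis
      using abs_inner_bound[OF t(1,2), of y \<eta> y' \<eta>'] by (simp add: pq) (meson ennreal_leI order_trans)
  qed
  show ?thesis
    using bound[of q p] bound[of p q] assms by (cases "snd (snd q) \<le> snd (snd p)") (auto simp: mult.commute)
qed

text \<open>Crude bounds from a b <= a^2 + b^2. They depend on \<tau> and serve only to make the
  integrals over truncated sets finite.\<close>

lemma coeff_integral_finite_le:
  assumes f [measurable]: "f \<in> borel_measurable borel" and f2: "integrable lborel (\<lambda>x. (norm (f x))\<^sup>2)"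
    and \<tau>: "0 < \<tau>" "\<tau> \<le> snd (snd p)"
  shows "(\<integral>\<^sup>+x. ennreal (norm (wave_packet \<phi> p x) * norm (f x)) \<partial>lborel)
      \<le> ennreal (4 * pi * K\<^sup>2 / \<tau> + (LBINT x. (norm (f x))\<^sup>2))" (is ?A)
    and "norm (coeff f p) \<le> 4 * pi * K\<^sup>2 / \<tau> + (LBINT x. (norm (f x))\<^sup>2)" (is ?B)
proof -
  have nn: "0 \<le> (LBINT x. (norm (f x))\<^sup>2)" by simp
  have "(\<integral>\<^sup>+x. ennreal (norm (wave_packet \<phi> p x) * norm (f x)) \<partial>lborel)
    \<le> (\<integral>\<^sup>+x. ennreal (norm (wave_packet \<phi> p x) * norm (wave_packet \<phi> p x)) + ennreal ((norm (f x))\<^sup>2) \<partial>lborel)"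
  proof (intro nn_integral_mono)
    fix x
    have "norm (wave_packet \<phi> p x) * norm (f x) \<le> norm (wave_packet \<phi> p x) * norm (wave_packet \<phi> p x) + (norm (f x))\<^sup>2"
    proof (cases "norm (wave_packet \<phi> p x) \<le> norm (f x)")
      case True
      then show ?thesis
        using mult_right_mono[OF True, of "norm (f x)"] by (simp add: power2_eq_square add_increasing)
    next
      case False
      then show ?thesis
        using mult_left_mono[of "norm (f x)" "norm (wave_packet \<phi> p x)" "norm (wave_packet \<phi> p x)"] by (simp add: add_increasing2)
    qed
    then show "ennreal (norm (wave_packet \<phi> p x) * norm (f x))
      \<le> ennreal (norm (wave_packet \<phi> p x) * norm (wave_packet \<phi> p x)) + ennreal ((norm (f x))\<^sup>2)"
      by (simp add: ennreal_plus[symmetric] del: ennreal_plus)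
  qed
  also have "\<dots> = (\<integral>\<^sup>+x. ennreal (norm (wave_packet \<phi> p x) * norm (wave_packet \<phi> p x)) \<partial>lborel) + ennreal (LBINT x. (norm (f x))\<^sup>2)"
    by (subst nn_integral_add) (auto simp: nn_integral_eq_integral[OF f2])
  also have "\<dots> \<le> ennreal (4 * pi * K\<^sup>2 / \<tau>) + ennreal (LBINT x. (norm (f x))\<^sup>2)"
    using \<tau> by (intro add_right_mono abs_inner_le) auto
  finally show A: ?A using \<tau> nn by (simp add: ennreal_plus[symmetric] del: ennreal_plus)
  have i: "integrable lborel (\<lambda>x. f x * cnj (wave_packet \<phi> p x))"
    using A by (intro integrableI_bounded) (auto simp: norm_mult mult.commute intro: le_less_trans)
  have "ennreal (norm (coeff f p)) \<le> ennreal (4 * pi * K\<^sup>2 / \<tau> + (LBINT x. (norm (f x))\<^sup>2))"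
    using integral_norm_bound_ennreal[OF i] A by (simp add: coeff_def norm_mult mult.commute)
  then show ?B using \<tau> nn by (subst (asm) ennreal_le_iff) auto
qed

text \<open>TT* is applied to the packets multiplied by their own coefficients and cut off to P:
  pairing f with such a vector gives |coeff f p|^2. Finite measure and scales above \<tau> provide
  the absolute convergence. The second claim is what later permits subtracting a multiple of the
  energy from both sides.\<close>

lemma TTstar_coeff:
  assumes f [measurable]: "f \<in> borel_measurable borel" and f2: "integrable lborel (\<lambda>x. (norm (f x))\<^sup>2)"
    and P [measurable]: "P \<in> sets borel" and fin: "emeasure lborel P < \<infinity>"
    and \<tau>: "0 < \<tau>" and P\<tau>: "\<And>p. p \<in> P \<Longrightarrow> \<tau> \<le> snd (snd p)" and l: "0 < l"
  shows "ennreal (2 * l) * (\<integral>\<^sup>+p. indicator P p * ennreal ((norm (coeff f p))\<^sup>2) \<partial>lborel)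
    \<le> ennreal (l\<^sup>2 * (LBINT x. (norm (f x))\<^sup>2))
      + (\<integral>\<^sup>+p. \<integral>\<^sup>+q. indicator P p * (indicator P q * ennreal (norm (coeff f p) * norm (coeff f q) * kernel p q)) \<partial>lborel \<partial>lborel)"
    and "(\<integral>\<^sup>+p. indicator P p * ennreal ((norm (coeff f p))\<^sup>2) \<partial>lborel) < \<infinity>"
proof -
  define \<kappa> where "\<kappa> = 4 * pi * K\<^sup>2 / \<tau>"
  define M where "M = 4 * pi * K\<^sup>2 / \<tau> + (LBINT x. (norm (f x))\<^sup>2)"
  have M: "0 \<le> M" "0 \<le> \<kappa>" using \<tau> by (simp_all add: M_def \<kappa>_def)
  have FM: "norm (coeff f p) \<le> M" if "p \<in> P" for p
    using coeff_integral_finite_le(2)[OF f f2 \<tau> P\<tau>[OF that]] by (simp add: M_def)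
  have IM: "(\<integral>\<^sup>+x. ennreal (norm (wave_packet \<phi> p x) * norm (f x)) \<partial>lborel) \<le> ennreal M" if "p \<in> P" for p
    using coeff_integral_finite_le(1)[OF f f2 \<tau> P\<tau>[OF that]] by (simp add: M_def)
  define \<Psi> where "\<Psi> p x = indicat_real P p *\<^sub>R (coeff f p * wave_packet \<phi> p x)" for p x
  have \<Psi>_meas: "(\<lambda>(p, x). \<Psi> p x) \<in> borel_measurable (lborel \<Otimes>\<^sub>M lborel)"
    unfolding \<Psi>_def[abs_def] by measurable
  have n\<Psi>: "norm (\<Psi> p x) = indicator P p * norm (coeff f p) * norm (wave_packet \<phi> p x)" for p x
    by (simp add: \<Psi>_def norm_mult)
  have const: "(\<integral>\<^sup>+p. ennreal c * indicator P p \<partial>lborel) < \<infinity>" for c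
    using fin by (simp add: nn_integral_cmult ennreal_mult_less_top)
  have fin1: "(\<integral>\<^sup>+p. \<integral>\<^sup>+x. ennreal (norm (\<Psi> p x) * norm (f x)) \<partial>lborel \<partial>lborel) < \<infinity>"
  proof -
    have "(\<integral>\<^sup>+p. \<integral>\<^sup>+x. ennreal (norm (\<Psi> p x) * norm (f x)) \<partial>lborel \<partial>lborel) \<le> (\<integral>\<^sup>+p. ennreal (M * M) * indicator P p \<partial>lborel)"
    proof (intro nn_integral_mono)
      fix p
      show "(\<integral>\<^sup>+x. ennreal (norm (\<Psi> p x) * norm (f x)) \<partial>lborel) \<le> ennreal (M * M) * indicator P p"
      proof (cases "p \<in> P")
        case True
        then have "(\<integral>\<^sup>+x. ennreal (norm (\<Psi> p x) * norm (f x)) \<partial>lborel)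
          = ennreal (norm (coeff f p)) * (\<integral>\<^sup>+x. ennreal (norm (wave_packet \<phi> p x) * norm (f x)) \<partial>lborel)"
          by (subst nn_integral_cmult[symmetric]) (auto simp: n\<Psi> ennreal_mult[symmetric] mult.assoc)
        also have "\<dots> \<le> ennreal M * ennreal M"
          using FM[OF True] IM[OF True] by (intro mult_mono ennreal_leI) auto
        finally show ?thesis using True M by (simp add: ennreal_mult)
      qed (simp add: n\<Psi>)
    qed
    then show ?thesis using const by (rule le_less_trans)
  qed
  have fin2: "(\<integral>\<^sup>+p. \<integral>\<^sup>+q. \<integral>\<^sup>+x. ennreal (norm (\<Psi> p x) * norm (\<Psi> q x)) \<partial>lborel \<partial>lborel \<partial>lborel) < \<infinity>"
  proof -
    have "(\<integral>\<^sup>+p. \<integral>\<^sup>+q. \<integral>\<^sup>+x. ennreal (norm (\<Psi> p x) * norm (\<Psi> q x)) \<partial>lborel \<partial>lborel \<partial>lborel)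
      \<le> (\<integral>\<^sup>+p. \<integral>\<^sup>+q. ennreal (M * M * \<kappa>) * indicator P q * indicator P p \<partial>lborel \<partial>lborel)"
    proof (intro nn_integral_mono)
      fix p q
      show "(\<integral>\<^sup>+x. ennreal (norm (\<Psi> p x) * norm (\<Psi> q x)) \<partial>lborel) \<le> ennreal (M * M * \<kappa>) * indicator P q * indicator P p"
      proof (cases "p \<in> P \<and> q \<in> P")
        case True
        then have "(\<integral>\<^sup>+x. ennreal (norm (\<Psi> p x) * norm (\<Psi> q x)) \<partial>lborel)
          = ennreal (norm (coeff f p) * norm (coeff f q)) * (\<integral>\<^sup>+x. ennreal (norm (wave_packet \<phi> p x) * norm (wave_packet \<phi> q x)) \<partial>lborel)"
          by (subst nn_integral_cmult[symmetric]) (auto simp: n\<Psi> ennreal_mult[symmetric] mult_ac)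
        also have "\<dots> \<le> ennreal (M * M) * ennreal \<kappa>"
          using True FM M \<tau> P\<tau> abs_inner_le[of \<tau> p q, folded \<kappa>_def] by (intro mult_mono ennreal_leI) auto
        finally show ?thesis using True M by (simp add: ennreal_mult)
      qed (auto simp: n\<Psi>)
    qed
    also have "\<dots> = (\<integral>\<^sup>+p. ennreal (M * M * \<kappa>) * indicator P p \<partial>lborel) * emeasure lborel P"
      by (simp add: nn_integral_multc nn_integral_cmult mult_ac)
    also have "\<dots> < \<infinity>"
      using const[of "M * M * \<kappa>"] fin by (simp add: ennreal_mult_less_top)
    finally show ?thesis .
  qed
  have sq_le: "indicator P p * ennreal ((norm (coeff f p))\<^sup>2) \<le> ennreal (M\<^sup>2) * indicator P p" for p
    using FM[of p] by (auto simp: indicator_def intro!: ennreal_leI power_mono)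
  show fin3: "(\<integral>\<^sup>+p. indicator P p * ennreal ((norm (coeff f p))\<^sup>2) \<partial>lborel) < \<infinity>"
    by (rule le_less_trans[OF nn_integral_mono[OF sq_le] const])
  have inner1: "(LBINT x. f x * cnj (\<Psi> p x)) = complex_of_real (indicator P p * (norm (coeff f p))\<^sup>2)" for p
  proof -
    have "(LBINT x. f x * cnj (\<Psi> p x)) = (LBINT x. (indicat_real P p *\<^sub>R cnj (coeff f p)) * (f x * cnj (wave_packet \<phi> p x)))"
      by (rule Bochner_Integration.integral_cong) (auto simp: \<Psi>_def)
    also have "\<dots> = (indicat_real P p *\<^sub>R cnj (coeff f p)) * coeff f p"
      by (simp only: integral_mult_right_zero coeff_def)
    also have "\<dots> = complex_of_real (indicator P p * (norm (coeff f p))\<^sup>2)"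
      by (simp add: scaleR_conv_of_real complex_norm_square mult.commute del: of_real_power)
    finally show ?thesis .
  qed
  have inner2: "ennreal (norm (LBINT x. \<Psi> p x * cnj (\<Psi> q x)))
    = indicator P p * (indicator P q * ennreal (norm (coeff f p) * norm (coeff f q) * kernel p q))" for p q
  proof -
    have "(LBINT x. \<Psi> p x * cnj (\<Psi> q x)) = (LBINT x. (indicat_real P p *\<^sub>R indicat_real P q *\<^sub>R (coeff f p * cnj (coeff f q))) * (wave_packet \<phi> p x * cnj (wave_packet \<phi> q x)))"
      by (rule Bochner_Integration.integral_cong) (auto simp: \<Psi>_def scaleR_conv_of_real mult_ac)
    also have "norm \<dots> = indicator P p * (indicator P q * (norm (coeff f p) * norm (coeff f q) * kernel p q))"
      by (simp add: integral_mult_right_zero norm_mult kernel_def del: Bochner_Integration.integral_mult_right)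
    finally show ?thesis by (simp add: indicator_def)
  qed
  have S: "(\<integral>\<^sup>+p. indicator P p * ennreal ((norm (coeff f p))\<^sup>2) \<partial>lborel)
    = ennreal (LBINT p. indicator P p * (norm (coeff f p))\<^sup>2)"
  proof -
    have eq: "indicator P p * ennreal ((norm (coeff f p))\<^sup>2) = ennreal (indicator P p * (norm (coeff f p))\<^sup>2)" for p
      by (simp add: indicator_def)
    show ?thesis
      unfolding eq using fin3 unfolding eq
      by (intro nn_integral_eq_integral integrableI_bounded) (auto simp: abs_mult)
  qed
  have Re_eq: "Re (LBINT p. (LBINT x. f x * cnj (\<Psi> p x))) = (LBINT p. indicator P p * (norm (coeff f p))\<^sup>2)"
    unfolding inner1 integral_complex_of_real by simp
  show "ennreal (2 * l) * (\<integral>\<^sup>+p. indicator P p * ennreal ((norm (coeff f p))\<^sup>2) \<partial>lborel)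
    \<le> ennreal (l\<^sup>2 * (LBINT x. (norm (f x))\<^sup>2))
      + (\<integral>\<^sup>+p. \<integral>\<^sup>+q. indicator P p * (indicator P q * ennreal (norm (coeff f p) * norm (coeff f q) * kernel p q)) \<partial>lborel \<partial>lborel)"
    using TTstar_inequality[OF sigma_finite_lborel sigma_finite_lborel \<Psi>_meas _ f2 fin1 fin2 l] l
    unfolding inner2 Re_eq S by (simp add: ennreal_mult[symmetric])
qed

end

section \<open>Energy estimates\<close>

context band_limited_window
begin

abbreviation scale :: "real \<times> real \<times> real \<Rightarrow> real" where
  "scale p \<equiv> snd (snd p)"

definition energy :: "(real \<Rightarrow> complex) \<Rightarrow> (real \<times> real \<times> real) set \<Rightarrow> ennreal" where
  "energy f P = (\<integral>\<^sup>+p. indicator P p * ennreal ((norm (coeff f p))\<^sup>2) \<partial>lborel)"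

definition interaction :: "(real \<Rightarrow> complex) \<Rightarrow> (real \<times> real \<times> real) set \<Rightarrow> real \<times> real \<times> real \<Rightarrow> real \<times> real \<times> real \<Rightarrow> ennreal" where
  "interaction f P p q = indicator P p * (indicator P q * ennreal (norm (coeff f p) * norm (coeff f q) * kernel p q))"

lemma interaction_measurable [measurable]:
  assumes [measurable]: "f \<in> borel_measurable borel" "P \<in> sets borel"
  shows "(\<lambda>(p, q). interaction f P p q) \<in> borel_measurable (borel \<Otimes>\<^sub>M borel)"
  unfolding interaction_def[abs_def] by measurable

lemma interaction_commute: "interaction f P p q = interaction f P q p"
  by (simp add: interaction_def kernel_commute[of p q] mult_ac)

text \<open>By symmetry the pairs whose second scale is larger can be exchanged with the others;
  pairs of equal scale are counted twice, which only enlarges the bound.\<close>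

lemma interaction_le_ordered:
  assumes [measurable]: "f \<in> borel_measurable borel" "P \<in> sets borel"
  shows "(\<integral>\<^sup>+p. \<integral>\<^sup>+q. interaction f P p q \<partial>lborel \<partial>lborel)
    \<le> 2 * (\<integral>\<^sup>+p. \<integral>\<^sup>+q. (if scale q \<le> scale p then interaction f P p q else 0) \<partial>lborel \<partial>lborel)"
proof -
  have "(\<integral>\<^sup>+p. \<integral>\<^sup>+q. interaction f P p q \<partial>lborel \<partial>lborel)
    \<le> (\<integral>\<^sup>+p. \<integral>\<^sup>+q. (if scale q \<le> scale p then interaction f P p q else 0)
        + (if scale p \<le> scale q then interaction f P p q else 0) \<partial>lborel \<partial>lborel)"
    by (intro nn_integral_mono) auto
  also have "\<dots> = (\<integral>\<^sup>+p. \<integral>\<^sup>+q. (if scale q \<le> scale p then interaction f P p q else 0) \<partial>lborel \<partial>lborel)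
      + (\<integral>\<^sup>+p. \<integral>\<^sup>+q. (if scale p \<le> scale q then interaction f P p q else 0) \<partial>lborel \<partial>lborel)"
    by (simp add: nn_integral_add)
  also have "(\<integral>\<^sup>+p. \<integral>\<^sup>+q. (if scale p \<le> scale q then interaction f P p q else 0) \<partial>lborel \<partial>lborel)
      = (\<integral>\<^sup>+q. \<integral>\<^sup>+p. (if scale p \<le> scale q then interaction f P p q else 0) \<partial>lborel \<partial>lborel)"
    by (rule lborel_pair.Fubini') measurable
  also have "\<dots> = (\<integral>\<^sup>+p. \<integral>\<^sup>+q. (if scale q \<le> scale p then interaction f P p q else 0) \<partial>lborel \<partial>lborel)"
    by (intro nn_integral_cong if_cong refl interaction_commute)
  finally show ?thesis by (simp add: mult_2)
qed

end

context separated_set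
begin

lemma schur_row_total:
  assumes "p \<in> P"
  shows "(\<integral>\<^sup>+q. indicator (P \<inter> {q. scale q \<le> scale p}) q * ennreal (kernel p q) \<partial>lborel) \<le> ennreal schur_const"
proof -
  obtain y \<eta> t where p: "p = (y, \<eta>, t)" by (cases p)
  have "{q :: real \<times> real \<times> real. scale q \<le> t} \<in> sets borel"
    by (intro borel_closed closed_Collect_le continuous_intros)
  then have "(\<integral>\<^sup>+q. indicator (P \<inter> {q. scale q \<le> t}) q * ennreal (kernel (y, \<eta>, t) q) \<partial>lborel) \<le> ennreal (schur_const * decay (0 / t))"
    using P_pos[of y \<eta> t] assms by (intro schur_row) (auto simp: p)
  then show ?thesis by (simp add: p decay_def)
qed

text \<open>On a level set F q is at most 2 |F p|, so the ordered double integral is controlled by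
  |F p|^2 times the row of p. Comparability of the coefficients takes the place of a column
  bound.\<close>

lemma energy_level_set:
  assumes f [measurable]: "f \<in> borel_measurable borel" and f2: "integrable lborel (\<lambda>x. (norm (f x))\<^sup>2)"
    and fin: "emeasure lborel P < \<infinity>"
    and \<tau>: "0 < \<tau>" "\<And>p. p \<in> P \<Longrightarrow> \<tau> \<le> scale p"
    and level: "\<And>p q. p \<in> P \<Longrightarrow> q \<in> P \<Longrightarrow> norm (coeff f q) \<le> 2 * norm (coeff f p)"
  shows "energy f P \<le> ennreal (4 * schur_const * (LBINT x. (norm (f x))\<^sup>2))"
proof -
  let ?n = "LBINT x. (norm (f x))\<^sup>2"
  have C: "0 < schur_const" by (rule schur_const_pos)
  have "(\<integral>\<^sup>+p. \<integral>\<^sup>+q. (if scale q \<le> scale p then interaction f P p q else 0) \<partial>lborel \<partial>lborel)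
    \<le> (\<integral>\<^sup>+p. (2 * schur_const) * (indicator P p * ennreal ((norm (coeff f p))\<^sup>2)) \<partial>lborel)"
  proof (intro nn_integral_mono)
    fix p
    show "(\<integral>\<^sup>+q. (if scale q \<le> scale p then interaction f P p q else 0) \<partial>lborel)
      \<le> (2 * schur_const) * (indicator P p * ennreal ((norm (coeff f p))\<^sup>2))"
    proof (cases "p \<in> P")
      case True
      have "(\<integral>\<^sup>+q. (if scale q \<le> scale p then interaction f P p q else 0) \<partial>lborel)
        \<le> (\<integral>\<^sup>+q. ennreal (2 * (norm (coeff f p))\<^sup>2) * (indicator (P \<inter> {q. scale q \<le> scale p}) q * ennreal (kernel p q)) \<partial>lborel)"
      proof (intro nn_integral_mono)
        fix q
        have "norm (coeff f p) * norm (coeff f q) * kernel p q \<le> 2 * (norm (coeff f p))\<^sup>2 * kernel p q" if "q \<in> P"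
          using mult_left_mono[OF level[OF True that], of "norm (coeff f p)"]
          by (intro mult_right_mono) (auto simp: power2_eq_square)
        then show "(if scale q \<le> scale p then interaction f P p q else 0)
          \<le> ennreal (2 * (norm (coeff f p))\<^sup>2) * (indicator (P \<inter> {q. scale q \<le> scale p}) q * ennreal (kernel p q))"
          by (auto simp: interaction_def indicator_def ennreal_mult[symmetric] simp del: ennreal_mult'' intro!: ennreal_leI)
      qed
      also have "\<dots> = ennreal (2 * (norm (coeff f p))\<^sup>2) * (\<integral>\<^sup>+q. indicator (P \<inter> {q. scale q \<le> scale p}) q * ennreal (kernel p q) \<partial>lborel)"
      proof (rule nn_integral_cmult)
        have [measurable]: "{q. scale q \<le> scale p} \<in> sets borel"
          by (intro borel_closed closed_Collect_le continuous_intros)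
        show "(\<lambda>q. indicator (P \<inter> {q. scale q \<le> scale p}) q * ennreal (kernel p q)) \<in> borel_measurable lborel"
          by measurable
      qed
      also have "\<dots> \<le> ennreal (2 * (norm (coeff f p))\<^sup>2) * ennreal schur_const"
        by (intro mult_left_mono schur_row_total True) auto
      finally show ?thesis using True C by (simp add: ennreal_mult[symmetric] mult_ac)
    qed (simp add: interaction_def cong: if_cong)
  qed
  also have "\<dots> = ennreal (2 * schur_const) * energy f P"
    unfolding energy_def by (rule nn_integral_cmult) measurable
  finally have Q: "(\<integral>\<^sup>+p. \<integral>\<^sup>+q. interaction f P p q \<partial>lborel \<partial>lborel) \<le> 2 * (ennreal (2 * schur_const) * energy f P)"
    by (intro order_trans[OF interaction_le_ordered[OF f P_borel]] mult_left_mono) auto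
  \<comment> \<open>With C = \<open>schur_const\<close> the full double integral is at most 4 C E,
    where E is the energy. Taking l = 4 C makes the left side 8 C E, and 4 C E <= 16 C^2 |f|^2
    remains after subtraction.\<close>
  note TT = TTstar_coeff[OF f f2 P_borel fin \<tau>, of "4 * schur_const", folded energy_def interaction_def]
  obtain e where e: "energy f P = ennreal e" "0 \<le> e"
    using TT(2) C by (cases "energy f P") auto
  have "ennreal (2 * (4 * schur_const)) * ennreal e
    \<le> ennreal ((4 * schur_const)\<^sup>2 * ?n) + 2 * (ennreal (2 * schur_const) * ennreal e)"
    using TT(1) C Q unfolding e(1) by (meson add_left_mono mult_pos_pos order_trans zero_less_numeral)
  also have "\<dots> = ennreal ((4 * schur_const)\<^sup>2 * ?n + 2 * (2 * schur_const * e))"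
    unfolding mult_2[of "ennreal _ * _"] using C e(2)
    by (simp only: ennreal_mult[symmetric] ennreal_plus[symmetric] mult_nonneg_nonneg integral_nonneg zero_le_power2 add_nonneg_nonneg less_imp_le zero_le_numeral) (simp add: ennreal_plus[symmetric] del: ennreal_plus)
  finally have "ennreal (2 * (4 * schur_const) * e) \<le> ennreal ((4 * schur_const)\<^sup>2 * ?n + 2 * (2 * schur_const * e))"
    using C e(2) by (subst ennreal_mult) auto
  then have "2 * (4 * schur_const) * e \<le> (4 * schur_const)\<^sup>2 * ?n + 2 * (2 * schur_const * e)"
    using C e(2) by (subst (asm) ennreal_le_iff) auto
  then have "(4 * schur_const) * e \<le> (4 * schur_const) * (4 * schur_const * ?n)"
    by (simp add: power2_eq_square)
  then have "e \<le> 4 * schur_const * ?n"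
    using C by (subst (asm) mult_le_cancel_left_pos) auto
  then show ?thesis unfolding e(1) by (rule ennreal_leI)
qed

text \<open>Schur's test: the arithmetic-geometric mean inequality splits |F p| |F q| into half of
  |F p|^2 and half of |F q|^2. The first half is summed along rows and the second along columns,
  which are bounded for comparable scales.\<close>

lemma near_interaction:
  assumes f [measurable]: "f \<in> borel_measurable borel"
  shows "(\<integral>\<^sup>+p. \<integral>\<^sup>+q. (if scale q \<le> scale p \<and> scale p \<le> B * scale q then interaction f P p q else 0) \<partial>lborel \<partial>lborel)
    \<le> ennreal schur_const * energy f P"
proof -
  let ?N = "\<lambda>p q. scale q \<le> scale p \<and> scale p \<le> B * scale q"
  define h where "h p = indicator P p * ennreal ((norm (coeff f p))\<^sup>2 / 2)" for p
  have [measurable]: "h \<in> borel_measurable borel" unfolding h_def[abs_def] by measurable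
  have h_double: "2 * h p = indicator P p * ennreal ((norm (coeff f p))\<^sup>2)" for p
    unfolding mult_2 h_def by (cases "p \<in> P") (simp_all add: ennreal_plus[symmetric] del: ennreal_plus)
  have h2: "2 * (\<integral>\<^sup>+p. h p \<partial>lborel) = energy f P"
    unfolding energy_def
    by (subst nn_integral_cmult[symmetric], simp) (simp add: h_double)
  have pt: "(if ?N p q then interaction f P p q else 0)
      \<le> (if ?N p q then h p * (indicator P q * ennreal (kernel p q)) else 0) + (if ?N p q then h q * ennreal (kernel p q) else 0)" for p q
  proof -
    have "norm (coeff f p) * norm (coeff f q) \<le> (norm (coeff f p))\<^sup>2 / 2 + (norm (coeff f q))\<^sup>2 / 2"
      using zero_le_power2[of "norm (coeff f p) - norm (coeff f q)"] by (simp add: power2_eq_square algebra_simps)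
    then have "norm (coeff f p) * norm (coeff f q) * kernel p q \<le> ((norm (coeff f p))\<^sup>2 / 2 + (norm (coeff f q))\<^sup>2 / 2) * kernel p q"
      by (rule mult_right_mono) simp
    then have "ennreal (norm (coeff f p) * norm (coeff f q) * kernel p q)
      \<le> ennreal ((norm (coeff f p))\<^sup>2 / 2) * ennreal (kernel p q) + ennreal ((norm (coeff f q))\<^sup>2 / 2) * ennreal (kernel p q)"
      by (simp add: ennreal_mult[symmetric] ennreal_plus[symmetric] distrib_right del: ennreal_plus)
    then show ?thesis
      by (auto simp: interaction_def h_def indicator_def)
  qed
  have "(\<integral>\<^sup>+p. \<integral>\<^sup>+q. (if ?N p q then interaction f P p q else 0) \<partial>lborel \<partial>lborel)
    \<le> (\<integral>\<^sup>+p. \<integral>\<^sup>+q. (if ?N p q then h p * (indicator P q * ennreal (kernel p q)) else 0) + (if ?N p q then h q * ennreal (kernel p q) else 0) \<partial>lborel \<partial>lborel)"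
    by (intro nn_integral_mono pt)
  also have "\<dots> = (\<integral>\<^sup>+p. \<integral>\<^sup>+q. (if ?N p q then h p * (indicator P q * ennreal (kernel p q)) else 0) \<partial>lborel \<partial>lborel)
     + (\<integral>\<^sup>+p. \<integral>\<^sup>+q. (if ?N p q then h q * ennreal (kernel p q) else 0) \<partial>lborel \<partial>lborel)"
    by (simp add: nn_integral_add)
  also have "(\<integral>\<^sup>+p. \<integral>\<^sup>+q. (if ?N p q then h q * ennreal (kernel p q) else 0) \<partial>lborel \<partial>lborel)
    = (\<integral>\<^sup>+q. \<integral>\<^sup>+p. (if ?N p q then h q * ennreal (kernel p q) else 0) \<partial>lborel \<partial>lborel)"
    by (rule lborel_pair.Fubini') measurable
  also have "(\<integral>\<^sup>+q. \<integral>\<^sup>+p. (if ?N p q then h q * ennreal (kernel p q) else 0) \<partial>lborel \<partial>lborel) \<le> (\<integral>\<^sup>+q. h q * ennreal schur_const \<partial>lborel)"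
  proof (intro nn_integral_mono)
    fix q
    show "(\<integral>\<^sup>+p. (if ?N p q then h q * ennreal (kernel p q) else 0) \<partial>lborel) \<le> h q * ennreal schur_const"
    proof (cases "q \<in> P")
      case True
      obtain y' \<eta>' t' where q: "q = (y', \<eta>', t')" by (cases q)
      have [measurable]: "{p :: real \<times> real \<times> real. t' \<le> scale p \<and> scale p \<le> B * t'} \<in> sets borel"
        by (intro borel_closed closed_Collect_conj closed_Collect_le continuous_intros)
      have "(\<integral>\<^sup>+p. (if ?N p q then h q * ennreal (kernel p q) else 0) \<partial>lborel)
        = (\<integral>\<^sup>+p. h q * (indicator {p. t' \<le> scale p \<and> scale p \<le> B * t'} p * ennreal (kernel p q)) \<partial>lborel)"
        by (intro nn_integral_cong) (auto simp: q)
      also have "\<dots> = h q * (\<integral>\<^sup>+p. (indicator {p. t' \<le> scale p \<and> scale p \<le> B * t'} p * ennreal (kernel p q)) \<partial>lborel)"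
        by (rule nn_integral_cmult) measurable
      also have "\<dots> \<le> h q * ennreal schur_const"
        unfolding q using P_pos True by (intro mult_left_mono schur_column) (auto simp: q)
      finally show ?thesis .
    qed (simp add: h_def cong: if_cong)
  qed
  also have "(\<integral>\<^sup>+p. \<integral>\<^sup>+q. (if ?N p q then h p * (indicator P q * ennreal (kernel p q)) else 0) \<partial>lborel \<partial>lborel) \<le> (\<integral>\<^sup>+p. h p * ennreal schur_const \<partial>lborel)"
  proof (intro nn_integral_mono)
    fix p
    show "(\<integral>\<^sup>+q. (if ?N p q then h p * (indicator P q * ennreal (kernel p q)) else 0) \<partial>lborel) \<le> h p * ennreal schur_const"
    proof (cases "p \<in> P")
      case True
      have [measurable]: "{q :: real \<times> real \<times> real. scale q \<le> scale p} \<in> sets borel"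
        by (intro borel_closed closed_Collect_le continuous_intros)
      have "(\<integral>\<^sup>+q. (if ?N p q then h p * (indicator P q * ennreal (kernel p q)) else 0) \<partial>lborel)
        \<le> (\<integral>\<^sup>+q. h p * (indicator (P \<inter> {q. scale q \<le> scale p}) q * ennreal (kernel p q)) \<partial>lborel)"
        by (intro nn_integral_mono) (auto simp: indicator_def)
      also have "\<dots> = h p * (\<integral>\<^sup>+q. (indicator (P \<inter> {q. scale q \<le> scale p}) q * ennreal (kernel p q)) \<partial>lborel)"
        by (rule nn_integral_cmult) measurable
      also have "\<dots> \<le> h p * ennreal schur_const"
        by (intro mult_left_mono schur_row_total True) auto
      finally show ?thesis .
    qed (simp add: h_def cong: if_cong)
  qed
  also have "(\<integral>\<^sup>+p. h p * ennreal schur_const \<partial>lborel) + (\<integral>\<^sup>+p. h p * ennreal schur_const \<partial>lborel) = ennreal schur_const * energy f P"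
    by (simp add: nn_integral_multc mult_2[symmetric] h2[symmetric] mult_ac)
  finally show ?thesis by (simp add: add_right_mono)
qed

end

text \<open>In use, k is the index of a partial tent containing p. The clause on q places a much
  smaller q of close frequency outside the cross-section of that tent at the height of q; this is
  the form of separation used for far scales.\<close>

locale separated_tents = separated_set +
  fixes C1 C2 b :: real and I :: "nat set" and x \<xi> s :: "nat \<Rightarrow> real"
  assumes C1: "0 < C1" and C2: "0 < C2"
    and s_pos: "k \<in> I \<Longrightarrow> 0 < s k"
    and tents: "p \<in> P \<Longrightarrow> \<exists>k\<in>I. p \<in> tent (C1, C2, b) (x k) (\<xi> k) (s k) \<and>
      (\<forall>q\<in>P. B * scale q < scale p \<longrightarrow> \<bar>fst (snd p) - fst (snd q)\<bar> < 2 * \<delta> / scale q \<longrightarrow> s k - scale q < \<bar>x k - fst q\<bar>)"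
begin

text \<open>The value from \<open>nn_integral_tent_decay\<close> at c = 1 - 1 / B, the fraction of
  the distance to the ends of the base that survives in \<open>far_row\<close>.\<close>

definition tent_const :: real where
  "tent_const = 2 * pi * (C1 + C2) / (1 - 1 / B)"

lemma tent_const_pos: "0 < tent_const"
  using B C1 C2 by (simp add: tent_const_def)

text \<open>Let d = s k - |y - x k| be the distance from y to the complement of the base, so that t
  < d. An interacting q lies outside the cross-section at height t', hence |y - y'| > d - t'; since
  t' < t / B < d / B, at least (1 - 1 / B) d is left as the distance for the row bound.\<close>

lemma far_row:
  assumes p: "(y, \<eta>, t) \<in> P"
  shows "\<exists>k\<in>I. (y, \<eta>, t) \<in> tent (C1, C2, b) (x k) (\<xi> k) (s k) \<and>
    (\<integral>\<^sup>+q. indicator (P \<inter> {q. B * scale q < t}) q * ennreal (kernel (y, \<eta>, t) q) \<partial>lborel)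
      \<le> ennreal (schur_const * decay ((1 - 1 / B) * (s k - \<bar>y - x k\<bar>) / t))"
proof -
  obtain k where k: "k \<in> I" "(y, \<eta>, t) \<in> tent (C1, C2, b) (x k) (\<xi> k) (s k)"
    and far: "\<And>q. q \<in> P \<Longrightarrow> B * scale q < t \<Longrightarrow> \<bar>\<eta> - fst (snd q)\<bar> < 2 * \<delta> / scale q \<Longrightarrow> s k - scale q < \<bar>x k - fst q\<bar>"
    using tents[OF p] by auto
  have t: "0 < t" using P_pos[OF p] .
  define d where "d = s k - \<bar>y - x k\<bar>"
  have d: "t < d" using k(2) by (simp add: tent_def d_def)
  have "{q :: real \<times> real \<times> real. B * scale q < t} \<in> sets borel"
    by (intro borel_open open_Collect_less continuous_intros)
  then have "(\<integral>\<^sup>+q. indicator (P \<inter> {q. B * scale q < t}) q * ennreal (kernel (y, \<eta>, t) q) \<partial>lborel)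
      \<le> ennreal (schur_const * decay ((1 - 1 / B) * d / t))"
  proof (intro schur_row t)
    show "0 \<le> (1 - 1 / B) * d" using B d t by simp
    fix y' \<eta>' t' assume q: "(y', \<eta>', t') \<in> P \<inter> {q. B * scale q < t}"
    then have t': "0 < t'" "B * t' < t" using P_pos by auto
    have "t' \<le> B * t'" using B t' mult_right_mono[of 1 B t'] by simp
    then show "t' \<le> t" using t' by linarith
    assume "\<bar>\<eta> - \<eta>'\<bar> < 2 * \<delta> / t'"
    then have "s k - t' < \<bar>x k - y'\<bar>" using far[of "(y', \<eta>', t')"] q by simp
    then have "d - t' \<le> \<bar>y - y'\<bar>" unfolding d_def by linarith
    moreover have "t' \<le> d / B"
      using t' d B by (simp add: field_simps)
    moreover have "(1 - 1 / B) * d = d - d / B" by (simp add: algebra_simps)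
    ultimately show "(1 - 1 / B) * d \<le> \<bar>y - y'\<bar>" by linarith
  qed auto
  then show ?thesis using k by (auto simp: d_def)
qed

lemma far_interaction:
  assumes f [measurable]: "f \<in> borel_measurable borel" and A: "0 \<le> A" "\<And>p. p \<in> P \<Longrightarrow> norm (coeff f p) \<le> A"
  shows "(\<integral>\<^sup>+p. \<integral>\<^sup>+q. (if B * scale q < scale p then interaction f P p q else 0) \<partial>lborel \<partial>lborel)
    \<le> ennreal (A\<^sup>2 * schur_const * tent_const) * (\<Sum>k. if k \<in> I then ennreal (s k) else 0)"
proof -
  note C = schur_const_pos tent_const_pos
  define c where "c = 1 - 1 / B"
  have c: "0 < c" using B by (simp add: c_def)
  \<comment> \<open>The tent found for p varies with p. Dominating its term by the sum over all
    tents avoids a measurable choice of k and makes the bound additive in the widths.\<close>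
  define G where "G k p = (if k \<in> I then indicator (tent (C1, C2, b) (x k) (\<xi> k) (s k)) p
      * ennreal (decay (c * (s k - \<bar>fst p - x k\<bar>) / scale p)) else 0)" for k p
  have [measurable]: "G k \<in> borel_measurable borel" for k
    unfolding G_def[abs_def] by measurable
  have row: "(\<integral>\<^sup>+q. (if B * scale q < scale p then interaction f P p q else 0) \<partial>lborel)
    \<le> ennreal (A\<^sup>2 * schur_const) * (\<Sum>k. G k p)" for p
  proof (cases "p \<in> P")
    case True
    obtain y \<eta> t where p: "p = (y, \<eta>, t)" by (cases p)
    obtain k where k: "k \<in> I" "p \<in> tent (C1, C2, b) (x k) (\<xi> k) (s k)"
      and row: "(\<integral>\<^sup>+q. indicator (P \<inter> {q. B * scale q < t}) q * ennreal (kernel p q) \<partial>lborel)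
        \<le> ennreal (schur_const * decay (c * (s k - \<bar>y - x k\<bar>) / t))"
      using far_row[of y \<eta> t] True by (auto simp: p c_def)
    have [measurable]: "{q :: real \<times> real \<times> real. B * scale q < t} \<in> sets borel"
      by (intro borel_open open_Collect_less continuous_intros)
    have "(\<integral>\<^sup>+q. (if B * scale q < scale p then interaction f P p q else 0) \<partial>lborel)
      \<le> (\<integral>\<^sup>+q. ennreal (A\<^sup>2) * (indicator (P \<inter> {q. B * scale q < t}) q * ennreal (kernel p q)) \<partial>lborel)"
    proof (intro nn_integral_mono)
      fix q
      have "norm (coeff f p) * norm (coeff f q) * kernel p q \<le> A\<^sup>2 * kernel p q" if "q \<in> P"
        unfolding power2_eq_square using A True that by (intro mult_right_mono mult_mono) auto
      then have "ennreal (norm (coeff f p) * norm (coeff f q) * kernel p q) \<le> ennreal (A\<^sup>2) * ennreal (kernel p q)" if "q \<in> P"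
        using that by (simp only: ennreal_mult[symmetric] zero_le_power2 kernel_nonneg ennreal_leI)
      then show "(if B * scale q < scale p then interaction f P p q else 0)
        \<le> ennreal (A\<^sup>2) * (indicator (P \<inter> {q. B * scale q < t}) q * ennreal (kernel p q))"
        by (auto simp: interaction_def indicator_def p)
    qed
    also have "\<dots> = ennreal (A\<^sup>2) * (\<integral>\<^sup>+q. indicator (P \<inter> {q. B * scale q < t}) q * ennreal (kernel p q) \<partial>lborel)"
      by (rule nn_integral_cmult) measurable
    also have "\<dots> \<le> ennreal (A\<^sup>2) * ennreal (schur_const * decay (c * (s k - \<bar>y - x k\<bar>) / t))"
      by (intro mult_left_mono row) auto
    also have "\<dots> = ennreal (A\<^sup>2 * schur_const) * G k p"
      using C k by (simp add: G_def p ennreal_mult[symmetric] mult.assoc)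
    also have "\<dots> \<le> ennreal (A\<^sup>2 * schur_const) * (\<Sum>k. G k p)"
      using sum_le_suminf[of "\<lambda>k. G k p" "{k}"] by (intro mult_left_mono) auto
    finally show ?thesis .
  qed (simp add: interaction_def cong: if_cong)
  have "(\<integral>\<^sup>+p. \<integral>\<^sup>+q. (if B * scale q < scale p then interaction f P p q else 0) \<partial>lborel \<partial>lborel)
    \<le> (\<integral>\<^sup>+p. ennreal (A\<^sup>2 * schur_const) * (\<Sum>k. G k p) \<partial>lborel)"
    by (intro nn_integral_mono row)
  also have "\<dots> = ennreal (A\<^sup>2 * schur_const) * (\<Sum>k. \<integral>\<^sup>+p. G k p \<partial>lborel)"
    by (simp add: nn_integral_cmult nn_integral_suminf)
  also have "\<dots> \<le> ennreal (A\<^sup>2 * schur_const) * (\<Sum>k. ennreal tent_const * (if k \<in> I then ennreal (s k) else 0))"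
  proof (intro mult_left_mono suminf_le)
    fix k
    show "(\<integral>\<^sup>+p. G k p \<partial>lborel) \<le> ennreal tent_const * (if k \<in> I then ennreal (s k) else 0)"
    proof (cases "k \<in> I")
      case True
      then show ?thesis
        using nn_integral_tent_decay[OF C1 C2 c s_pos[OF True], of b "x k" "\<xi> k"] C s_pos[OF True]
        by (simp add: G_def tent_const_def c_def ennreal_mult[symmetric])
    qed (simp add: G_def)
  qed auto
  also have "\<dots> = ennreal (A\<^sup>2 * schur_const * tent_const) * (\<Sum>k. if k \<in> I then ennreal (s k) else 0)"
    using C by (simp add: ennreal_suminf_cmult ennreal_mult mult.assoc)
  finally show ?thesis .
qed

text \<open>Pairs of comparable scale cost a multiple of the energy, which is absorbed; pairs of far
  scales cost A^2 times the total width of the tents.\<close>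

lemma energy_low_set:
  assumes f [measurable]: "f \<in> borel_measurable borel" and f2: "integrable lborel (\<lambda>x. (norm (f x))\<^sup>2)"
    and fin: "emeasure lborel P < \<infinity>"
    and \<tau>: "0 < \<tau>" "\<And>p. p \<in> P \<Longrightarrow> \<tau> \<le> scale p"
    and A: "0 \<le> A" "\<And>p. p \<in> P \<Longrightarrow> norm (coeff f p) \<le> A"
    and \<Sigma>: "(\<Sum>k. if k \<in> I then ennreal (s k) else 0) \<le> ennreal \<Sigma>" "0 \<le> \<Sigma>"
  shows "energy f P \<le> ennreal (2 * schur_const * (LBINT x. (norm (f x))\<^sup>2) + A\<^sup>2 * tent_const * \<Sigma>)"
proof -
  let ?n = "LBINT x. (norm (f x))\<^sup>2"
  note C = schur_const_pos tent_const_pos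
  \<comment> \<open>With C = \<open>schur_const\<close> the comparable scales contribute 2 C E to
    the full double integral, E being the energy. Taking l = 2 C makes the left side 4 C E and
    leaves 2 C E after subtraction.\<close>
  note TT = TTstar_coeff[OF f f2 P_borel fin \<tau>, of "2 * schur_const", folded energy_def interaction_def]
  obtain e where e: "energy f P = ennreal e" "0 \<le> e"
    using TT(2) C by (cases "energy f P") auto
  have "(\<integral>\<^sup>+p. \<integral>\<^sup>+q. (if scale q \<le> scale p then interaction f P p q else 0) \<partial>lborel \<partial>lborel)
    \<le> (\<integral>\<^sup>+p. \<integral>\<^sup>+q. (if scale q \<le> scale p \<and> scale p \<le> B * scale q then interaction f P p q else 0)
      + (if B * scale q < scale p then interaction f P p q else 0) \<partial>lborel \<partial>lborel)"
    by (intro nn_integral_mono) auto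
  also have "\<dots> = (\<integral>\<^sup>+p. \<integral>\<^sup>+q. (if scale q \<le> scale p \<and> scale p \<le> B * scale q then interaction f P p q else 0) \<partial>lborel \<partial>lborel)
      + (\<integral>\<^sup>+p. \<integral>\<^sup>+q. (if B * scale q < scale p then interaction f P p q else 0) \<partial>lborel \<partial>lborel)"
    by (simp add: nn_integral_add)
  also have "\<dots> \<le> ennreal schur_const * ennreal e + ennreal (A\<^sup>2 * schur_const * tent_const) * ennreal \<Sigma>"
    using near_interaction[OF f] order_trans[OF far_interaction[OF f A] mult_left_mono[OF \<Sigma>(1)]] e(1)
    by (intro add_mono) auto
  also have "\<dots> = ennreal (schur_const * e + A\<^sup>2 * schur_const * tent_const * \<Sigma>)"
    using C e(2) \<Sigma>(2) by (simp add: ennreal_mult[symmetric] ennreal_plus[symmetric] del: ennreal_plus)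
  finally have "(\<integral>\<^sup>+p. \<integral>\<^sup>+q. interaction f P p q \<partial>lborel \<partial>lborel)
      \<le> 2 * ennreal (schur_const * e + A\<^sup>2 * schur_const * tent_const * \<Sigma>)"
    by (intro order_trans[OF interaction_le_ordered[OF f P_borel]] mult_left_mono) auto
  then have "ennreal (2 * (2 * schur_const)) * ennreal e
    \<le> ennreal ((2 * schur_const)\<^sup>2 * ?n) + 2 * ennreal (schur_const * e + A\<^sup>2 * schur_const * tent_const * \<Sigma>)"
    using TT(1) C unfolding e(1) by (meson add_left_mono mult_pos_pos order_trans zero_less_numeral)
  also have "\<dots> = ennreal ((2 * schur_const)\<^sup>2 * ?n + 2 * (schur_const * e + A\<^sup>2 * schur_const * tent_const * \<Sigma>))"
    unfolding mult_2[of "ennreal _"] using C e(2) \<Sigma>(2) by (simp add: ennreal_plus[symmetric] del: ennreal_plus)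
  finally have "ennreal (2 * (2 * schur_const) * e)
    \<le> ennreal ((2 * schur_const)\<^sup>2 * ?n + 2 * (schur_const * e + A\<^sup>2 * schur_const * tent_const * \<Sigma>))"
    using C e(2) by (subst ennreal_mult) auto
  then have "2 * (2 * schur_const) * e \<le> (2 * schur_const)\<^sup>2 * ?n + 2 * (schur_const * e + A\<^sup>2 * schur_const * tent_const * \<Sigma>)"
    using C e(2) \<Sigma>(2) by (subst (asm) ennreal_le_iff) auto
  then have "(2 * schur_const) * e \<le> (2 * schur_const) * (2 * schur_const * ?n + A\<^sup>2 * tent_const * \<Sigma>)"
    by (simp add: power2_eq_square algebra_simps)
  then have "e \<le> 2 * schur_const * ?n + A\<^sup>2 * tent_const * \<Sigma>"
    using C by (subst (asm) mult_le_cancel_left_pos) auto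
  then show ?thesis unfolding e(1) by (rule ennreal_leI)
qed

end

section \<open>Restriction to subsets and exhaustion by boxes of finite measure\<close>

lemma (in separated_set) subset_separated:
  assumes "Q \<in> sets borel" "Q \<subseteq> P"
  shows "separated_set \<phi> K \<delta> B Q"
  using assms B P_pos slice by unfold_locales blast+

lemma (in separated_tents) subset_separated_tents:
  assumes "Q \<in> sets borel" "Q \<subseteq> P"
  shows "separated_tents \<phi> K \<delta> B Q C1 C2 b I x \<xi> s"
proof -
  interpret Q: separated_set \<phi> K \<delta> B Q using assms by (rule subset_separated)
  show ?thesis
  proof unfold_locales
    fix p assume "p \<in> Q"
    with assms tents[of p] obtain k where "k \<in> I" "p \<in> tent (C1, C2, b) (x k) (\<xi> k) (s k)"
      "\<And>q. q \<in> P \<Longrightarrow> B * scale q < scale p \<Longrightarrow> \<bar>fst (snd p) - fst (snd q)\<bar> < 2 * \<delta> / scale q \<Longrightarrow> s k - scale q < \<bar>x k - fst q\<bar>"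
      by auto
    with assms(2) show "\<exists>k\<in>I. p \<in> tent (C1, C2, b) (x k) (\<xi> k) (s k) \<and>
      (\<forall>q\<in>Q. B * scale q < scale p \<longrightarrow> \<bar>fst (snd p) - fst (snd q)\<bar> < 2 * \<delta> / scale q \<longrightarrow> s k - scale q < \<bar>x k - fst q\<bar>)"
      by (intro bexI[of _ k] conjI) auto
  qed (use C1 C2 s_pos in auto)
qed

text \<open>\<open>Suc n\<close> keeps the lower bound for the scales positive also at n = 0, so
  that it can serve as \<tau>.\<close>

definition trunc_box :: "nat \<Rightarrow> (real \<times> real \<times> real) set" where
  "trunc_box n = {- real n..real n} \<times> {- real n..real n} \<times> {1 / real (Suc n)..real n}"

lemma trunc_box_borel [measurable]: "trunc_box n \<in> sets borel"
  unfolding trunc_box_def by (intro borel_closed closed_Times closed_real_atLeastAtMost)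

lemma trunc_box_finite: "emeasure lborel (trunc_box n) < \<infinity>"
proof -
  have "trunc_box n = cbox (- real n, - real n, 1 / real (Suc n)) (real n, real n, real n)"
    by (simp add: trunc_box_def cbox_Pair_eq)
  then show ?thesis using emeasure_lborel_cbox_finite by (simp add: less_top[symmetric])
qed

lemma trunc_box_mono: "m \<le> n \<Longrightarrow> trunc_box m \<subseteq> trunc_box n"
  unfolding trunc_box_def by (intro Sigma_mono) (auto simp: frac_le)

lemma trunc_box_exhausts: "0 < t \<Longrightarrow> \<exists>n. (y, \<eta>, t) \<in> trunc_box n"
proof -
  assume t: "0 < t"
  obtain n where "max (max \<bar>y\<bar> \<bar>\<eta>\<bar>) (max t (1 / t)) \<le> real n"
    using real_arch_simple by blast
  then have n: "\<bar>y\<bar> \<le> real n" "\<bar>\<eta>\<bar> \<le> real n" "t \<le> real n" "1 / t \<le> real (Suc n)" by auto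
  have "1 / real (Suc n) \<le> t"
    using n(4) t by (simp add: field_simps)
  with n have "(y, \<eta>, t) \<in> trunc_box n" by (auto simp: trunc_box_def simp del: of_nat_Suc)
  then show ?thesis ..
qed

text \<open>Monotone convergence along the boxes; it removes the finiteness assumptions since the
  energy bounds do not depend on the box.\<close>

lemma (in band_limited_window) energy_le_if_truncations_le:
  assumes [measurable]: "f \<in> borel_measurable borel" "P \<in> sets borel"
    and pos: "\<And>p. p \<in> P \<Longrightarrow> 0 < scale p" and le: "\<And>n. energy f (P \<inter> trunc_box n) \<le> c"
  shows "energy f P \<le> c"
proof -
  let ?h = "\<lambda>n p. indicator (P \<inter> trunc_box n) p * ennreal ((norm (coeff f p))\<^sup>2)"
  have inc: "incseq ?h"
    using subsetD[OF trunc_box_mono[OF le_SucI[OF order_refl]]]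
    by (intro incseq_SucI le_funI mult_right_mono) (auto simp: indicator_def)
  have "indicator P p * ennreal ((norm (coeff f p))\<^sup>2) \<le> (SUP n. ?h n p)" for p
  proof (cases "p \<in> P")
    case True
    then obtain n where "p \<in> trunc_box n" using trunc_box_exhausts pos by (metis prod.collapse)
    with True show ?thesis by (intro SUP_upper2[of n]) auto
  qed simp
  then have "energy f P \<le> (\<integral>\<^sup>+p. (SUP n. ?h n p) \<partial>lborel)"
    unfolding energy_def by (intro nn_integral_mono)
  also have "\<dots> = (SUP n. energy f (P \<inter> trunc_box n))"
    unfolding energy_def by (rule nn_integral_monotone_convergence_SUP[OF inc]) measurable
  also have "\<dots> \<le> c" using le by (intro SUP_least) auto
  finally show ?thesis .
qed

lemma (in separated_set) energy_level:
  assumes f [measurable]: "f \<in> borel_measurable borel" and f2: "integrable lborel (\<lambda>x. (norm (f x))\<^sup>2)"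
    and level: "\<And>p q. p \<in> P \<Longrightarrow> q \<in> P \<Longrightarrow> norm (coeff f q) \<le> 2 * norm (coeff f p)"
  shows "energy f P \<le> ennreal (4 * schur_const * (LBINT x. (norm (f x))\<^sup>2))"
proof (rule energy_le_if_truncations_le)
  fix n
  interpret T: separated_set \<phi> K \<delta> B "P \<inter> trunc_box n" by (intro subset_separated) auto
  show "energy f (P \<inter> trunc_box n) \<le> ennreal (4 * schur_const * (LBINT x. (norm (f x))\<^sup>2))"
  proof (rule T.energy_level_set[OF f f2])
    show "emeasure lborel (P \<inter> trunc_box n) < \<infinity>"
      by (rule le_less_trans[OF emeasure_mono trunc_box_finite]) auto
    show "0 < 1 / real (Suc n)" by simp
  qed (use level in \<open>auto simp: trunc_box_def simp del: of_nat_Suc\<close>)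
qed (use P_pos in auto)

lemma (in separated_tents) energy_low:
  assumes f [measurable]: "f \<in> borel_measurable borel" and f2: "integrable lborel (\<lambda>x. (norm (f x))\<^sup>2)"
    and A: "0 \<le> A" "\<And>p. p \<in> P \<Longrightarrow> norm (coeff f p) \<le> A"
    and \<Sigma>: "(\<Sum>k. if k \<in> I then ennreal (s k) else 0) \<le> ennreal \<Sigma>" "0 \<le> \<Sigma>"
  shows "energy f P \<le> ennreal (2 * schur_const * (LBINT x. (norm (f x))\<^sup>2) + A\<^sup>2 * tent_const * \<Sigma>)"
proof (rule energy_le_if_truncations_le)
  fix n
  interpret T: separated_tents \<phi> K \<delta> B "P \<inter> trunc_box n" C1 C2 b I x \<xi> s by (intro subset_separated_tents) auto
  show "energy f (P \<inter> trunc_box n) \<le> ennreal (2 * schur_const * (LBINT x. (norm (f x))\<^sup>2) + A\<^sup>2 * tent_const * \<Sigma>)"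
  proof (rule T.energy_low_set[OF f f2 _ _ _ A(1) _ \<Sigma>])
    show "emeasure lborel (P \<inter> trunc_box n) < \<infinity>"
      by (rule le_less_trans[OF emeasure_mono trunc_box_finite]) auto
    show "0 < 1 / real (Suc n)" by simp
  qed (use A in \<open>auto simp: trunc_box_def simp del: of_nat_Suc\<close>)
qed (use P_pos in auto)

section \<open>Summation over the levels\<close>

context separated_tents
begin

text \<open>The levels are not counted but weighted: a nonempty level j has 2^j < r, so its bound
  may be multiplied by (r / 2^j)^(2 \<sigma>) >= 1. The levels then sum as a geometric series with
  ratio q < 1, which is the origin of the factor 1 / (1 - q).\<close>

lemma energy_bound:
  assumes f [measurable]: "f \<in> borel_measurable borel" and f2: "integrable lborel (\<lambda>x. (norm (f x))\<^sup>2)"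
    and A: "0 < A" "\<And>p. p \<in> P \<Longrightarrow> norm (coeff f p) \<le> A"
    and \<Sigma>: "(\<Sum>k. if k \<in> I then ennreal (s k) else 0) \<le> ennreal \<Sigma>" "0 < \<Sigma>"
    and n: "(LBINT x. (norm (f x))\<^sup>2) = n" "0 < n" and \<sigma>: "0 < \<sigma>"
  shows "energy f P \<le> ennreal ((2 * schur_const + tent_const) * n
    + 4 * schur_const / (1 - 2 powr (- (2 * \<sigma>))) * (n * (A * sqrt \<Sigma> / sqrt n) powr (2 * \<sigma>)))"
proof -
  note C = schur_const_pos tent_const_pos
  \<comment> \<open>The threshold with l^2 \<Sigma> = n: below it the far interactions cost no more
    than a multiple of n.\<close>
  define l where "l = sqrt n / sqrt \<Sigma>"
  have l: "0 < l" using n \<Sigma> by (simp add: l_def)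
  define r where "r = A * sqrt \<Sigma> / sqrt n"
  have r: "0 < r" "r = A / l" using n \<Sigma> A by (simp_all add: l_def r_def)
  define q where "q = 2 powr (- (2 * \<sigma>))"
  have q: "0 < q" "q < 1" using \<sigma> powr_less_mono[of "- (2 * \<sigma>)" 0 2] by (simp_all add: q_def)
  define c where "c = 4 * schur_const * (n * r powr (2 * \<sigma>))"
  have c: "0 \<le> c" using C n by (simp add: c_def)
  let ?low = "P \<inter> {p. norm (coeff f p) \<le> l}"
  let ?lev = "\<lambda>j. P \<inter> {p. 2 ^ j * l < norm (coeff f p) \<and> norm (coeff f p) \<le> 2 ^ Suc j * l}"
  have low_m [measurable]: "?low \<in> sets borel"
    by (intro sets.Int P_borel) measurable
  have lev_m [measurable]: "?lev j \<in> sets borel" for j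
    by (intro sets.Int P_borel) measurable
  have low: "energy f ?low \<le> ennreal ((2 * schur_const + tent_const) * n)"
  proof -
    interpret L: separated_tents \<phi> K \<delta> B ?low C1 C2 b I x \<xi> s
      by (intro subset_separated_tents low_m) auto
    have "energy f ?low \<le> ennreal (2 * schur_const * n + l\<^sup>2 * tent_const * \<Sigma>)"
      using L.energy_low[OF f f2, of l \<Sigma>] l \<Sigma> n(1) by auto
    also have "2 * schur_const * n + l\<^sup>2 * tent_const * \<Sigma> = (2 * schur_const + tent_const) * n"
      using n \<Sigma> by (simp add: l_def power_divide algebra_simps)
    finally show ?thesis .
  qed
  have lev: "energy f (?lev j) \<le> ennreal (c * q ^ j)" for j
  proof (cases "2 ^ j < r")
    case True
    interpret L: separated_set \<phi> K \<delta> B "?lev j"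
      by (intro subset_separated lev_m) auto
    have "energy f (?lev j) \<le> ennreal (4 * schur_const * n)"
      using L.energy_level[OF f f2] n(1) by auto
    also have "\<dots> \<le> ennreal (c * q ^ j)"
    proof (rule ennreal_leI)
      have "1 \<le> (r / 2 ^ j) powr (2 * \<sigma>)"
        using True \<sigma> by (intro ge_one_powr_ge_zero) auto
      also have "\<dots> = r powr (2 * \<sigma>) * q ^ j"
      proof -
        have "q ^ j = 1 / (2 ^ j) powr (2 * \<sigma>)"
          using powr_realpow[OF q(1), of j] powr_realpow[of 2 j]
          by (simp add: q_def powr_powr powr_minus_divide[symmetric] mult.commute flip: powr_realpow)
        then show ?thesis using r(1) by (simp add: powr_divide)
      qed
      finally have "4 * schur_const * n * 1 \<le> 4 * schur_const * n * (r powr (2 * \<sigma>) * q ^ j)"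
        using C n by (intro mult_left_mono) auto
      then show "4 * schur_const * n \<le> c * q ^ j" by (simp add: c_def mult_ac)
    qed
    finally show ?thesis .
  next
    case False
    have "?lev j = {}"
    proof -
      \<comment> \<open>If r <= 2^j, the bound A for all coefficients does not exceed the strict
        lower end of level j.\<close>
      have "A \<le> 2 ^ j * l" using False r l by (simp add: field_simps not_less)
      then show ?thesis using A(2) by fastforce
    qed
    then show ?thesis by (simp add: energy_def)
  qed
  have split: "indicator P p * ennreal ((norm (coeff f p))\<^sup>2)
    \<le> indicator ?low p * ennreal ((norm (coeff f p))\<^sup>2) + (\<Sum>j. indicator (?lev j) p * ennreal ((norm (coeff f p))\<^sup>2))" for p
  proof (cases "p \<in> P \<and> l < norm (coeff f p)")
    case True
    define v where "v = norm (coeff f p) / l"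
    have v: "1 < v" using True l by (simp add: v_def)
    \<comment> \<open>Since v > 1 excludes m = 0, there is j = m - 1; minimality of m gives the
      strict lower inequality of level j, and m itself the upper one.\<close>
    define m where "m = (LEAST m. v \<le> 2 ^ m)"
    have ex: "\<exists>m. v \<le> 2 ^ m"
      using real_arch_pow[of 2 v] by (auto intro: less_imp_le)
    have m: "v \<le> 2 ^ m" unfolding m_def by (rule LeastI_ex[OF ex])
    have "m \<noteq> 0" using m v by (cases m) auto
    then obtain j where j: "m = Suc j" by (cases m) auto
    have "\<not> v \<le> 2 ^ j" using not_less_Least[of j "\<lambda>m. v \<le> 2 ^ m"] j unfolding m_def by auto
    then have "p \<in> ?lev j"
      using m True l by (simp add: j v_def field_simps)
    then have "indicator P p * ennreal ((norm (coeff f p))\<^sup>2) \<le> (\<Sum>j. indicator (?lev j) p * ennreal ((norm (coeff f p))\<^sup>2))"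
      using sum_le_suminf[of "\<lambda>j. indicator (?lev j) p * ennreal ((norm (coeff f p))\<^sup>2)" "{j}"] True by simp
    then show ?thesis by (rule order_trans) simp
  qed (auto simp: indicator_def)
  define hlow where "hlow p = indicator ?low p * ennreal ((norm (coeff f p))\<^sup>2)" for p
  define hlev where "hlev j p = indicator (?lev j) p * ennreal ((norm (coeff f p))\<^sup>2)" for j p
  have g: "(\<lambda>p. ennreal ((norm (coeff f p))\<^sup>2)) \<in> borel_measurable borel" by measurable
  have [measurable]: "hlow \<in> borel_measurable borel"
    unfolding hlow_def[abs_def] by (rule borel_measurable_times_ennreal[OF borel_measurable_indicator[OF low_m] g])
  have [measurable]: "hlev j \<in> borel_measurable borel" for j
    unfolding hlev_def[abs_def] by (rule borel_measurable_times_ennreal[OF borel_measurable_indicator[OF lev_m] g])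
  have "energy f P \<le> (\<integral>\<^sup>+p. hlow p + (\<Sum>j. hlev j p) \<partial>lborel)"
    unfolding energy_def hlow_def hlev_def by (intro nn_integral_mono split)
  also have "\<dots> = (\<integral>\<^sup>+p. hlow p \<partial>lborel) + (\<Sum>j. \<integral>\<^sup>+p. hlev j p \<partial>lborel)"
    by (simp add: nn_integral_add nn_integral_suminf)
  also have "\<dots> = energy f ?low + (\<Sum>j. energy f (?lev j))"
    unfolding energy_def hlow_def hlev_def ..
  also have "\<dots> \<le> ennreal ((2 * schur_const + tent_const) * n) + (\<Sum>j. ennreal (c * q ^ j))"
    by (intro add_mono low suminf_le lev) auto
  also have "(\<Sum>j. ennreal (c * q ^ j)) = ennreal (c * (1 / (1 - q)))"
    using q c by (intro suminf_ennreal_eq sums_mult geometric_sums) auto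
  also have "ennreal ((2 * schur_const + tent_const) * n) + \<dots> = ennreal ((2 * schur_const + tent_const) * n + c * (1 / (1 - q)))"
    using C n q c by (intro ennreal_plus[symmetric]) auto
  finally show ?thesis by (simp add: c_def q_def r_def mult_ac)
qed

lemma sqrt_energy_bound:
  assumes f [measurable]: "f \<in> borel_measurable borel" and f2: "integrable lborel (\<lambda>x. (norm (f x))\<^sup>2)"
    and A: "0 < A" "\<And>p. p \<in> P \<Longrightarrow> norm (coeff f p) \<le> A"
    and \<Sigma>: "(\<Sum>k. if k \<in> I then ennreal (s k) else 0) \<le> ennreal \<Sigma>" "0 < \<Sigma>"
    and N: "sqrt (LBINT x. (norm (f x))\<^sup>2) = N" "0 < N" and \<sigma>: "0 < \<sigma>"
  shows "ennpow (energy f P) (1 / 2)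
    \<le> ennreal ((sqrt (2 * schur_const + tent_const) + sqrt (4 * schur_const / (1 - 2 powr (- (2 * \<sigma>)))))
        * (N + (A * sqrt \<Sigma>) powr \<sigma> * N powr (1 - \<sigma>)))"
proof -
  note C = schur_const_pos tent_const_pos
  define a where "a = 2 * schur_const + tent_const"
  define d where "d = 4 * schur_const / (1 - 2 powr (- (2 * \<sigma>)))"
  have ad: "0 \<le> a" "0 \<le> d" using C \<sigma> powr_less_mono[of "- (2 * \<sigma>)" 0 2] by (simp_all add: a_def d_def)
  \<comment> \<open>Y^2 is the term n r^(2 \<sigma>) of \<open>energy_bound\<close> with n = N^2.
    Taking roots turns the exponent 2 \<sigma> into the exponents \<sigma> and 1 - \<sigma> of the
    claim.\<close>
  define Y where "Y = (A * sqrt \<Sigma>) powr \<sigma> * N powr (1 - \<sigma>)"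
  have Y: "0 \<le> Y" by (simp add: Y_def)
  have n: "(LBINT x. (norm (f x))\<^sup>2) = N\<^sup>2" using N by auto
  have Y2: "N\<^sup>2 * (A * sqrt \<Sigma> / sqrt (N\<^sup>2)) powr (2 * \<sigma>) = Y\<^sup>2"
  proof -
    have "(z powr \<sigma>)\<^sup>2 = z powr (2 * \<sigma>)" for z :: real
      by (simp add: power2_eq_square powr_add[symmetric])
    then have "Y\<^sup>2 = (A * sqrt \<Sigma>) powr (2 * \<sigma>) * (N powr (1 - \<sigma>))\<^sup>2"
      by (simp add: Y_def power_mult_distrib)
    also have "(N powr (1 - \<sigma>))\<^sup>2 = N powr (2 - 2 * \<sigma>)"
      by (simp add: power2_eq_square powr_add[symmetric])
    also have "\<dots> = N\<^sup>2 / N powr (2 * \<sigma>)"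
      using N(2) by (simp add: powr_diff)
    finally show ?thesis using N(2) A(1) \<Sigma>(2) by (simp add: powr_divide)
  qed
  have E: "energy f P \<le> ennreal (a * N\<^sup>2 + d * Y\<^sup>2)"
    using energy_bound[OF f f2 A \<Sigma> n _ \<sigma>, unfolded Y2] N(2) by (simp add: a_def d_def)
  then obtain e where e: "energy f P = ennreal e" "0 \<le> e" by (cases "energy f P") (auto simp: top_unique)
  have "e \<le> a * N\<^sup>2 + d * Y\<^sup>2"
    using E ad unfolding e(1) by (subst (asm) ennreal_le_iff) auto
  then have "sqrt e \<le> sqrt (a * N\<^sup>2 + d * Y\<^sup>2)" by simp
  also have "\<dots> \<le> sqrt (a * N\<^sup>2) + sqrt (d * Y\<^sup>2)"
    using ad by (intro sqrt_add_le_add_sqrt) auto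
  also have "\<dots> = sqrt a * N + sqrt d * Y"
    using N(2) Y by (simp add: real_sqrt_mult)
  also have "\<dots> \<le> (sqrt a + sqrt d) * (N + Y)"
    using ad N(2) Y by (simp add: algebra_simps)
  finally have "sqrt e \<le> (sqrt a + sqrt d) * (N + Y)" .
  then show ?thesis
    using e by (simp add: ennpow_def powr_half_sqrt a_def d_def Y_def ennreal_leI)
qed

end

section \<open>From the hypotheses of the theorem to the locales\<close>

lemma schwartz_decay:
  assumes "schwartz \<phi>"
  shows "continuous_on UNIV \<phi>" and "\<exists>K>0. \<forall>u. norm (\<phi> u) \<le> K * decay u ^ 3"
proof -
  have s: "(\<forall>x. ((vderiv ^^ n) \<phi>) differentiable (at x)) \<and> (\<forall>m::nat. \<exists>K. \<forall>x. \<bar>x\<bar> ^ m * norm (((vderiv ^^ n) \<phi>) x) \<le> K)" for n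
    using assms unfolding schwartz_def by blast
  show "continuous_on UNIV \<phi>"
    using s[of 0] by (auto intro!: continuous_at_imp_continuous_on differentiable_imp_continuous_within)
  obtain K0 where K0: "\<And>x. \<bar>x\<bar> ^ 0 * norm (\<phi> x) \<le> K0" using s[of 0] by (metis funpow_0)
  obtain K6 where K6: "\<And>x. \<bar>x\<bar> ^ 6 * norm (\<phi> x) \<le> K6" using s[of 0] by (metis funpow_0)
  \<comment> \<open>The moments 0 and 6 control 1 + v^3 with v = u^2, the factor 4 passes from there
    to (1 + v)^3, and the summand 1 keeps K positive when \<phi> vanishes.\<close>
  define K where "K = 4 * (K0 + K6) + 1"
  have "0 \<le> K0" "0 \<le> K6" using K0[of 0] K6[of 0] by (auto intro: order_trans[OF norm_ge_zero])
  then have "0 < K" by (simp add: K_def)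
  moreover have "norm (\<phi> u) \<le> K * decay u ^ 3" for u
  proof -
    define v where "v = u\<^sup>2"
    have v: "0 \<le> v" by (simp add: v_def)
    have "\<bar>u\<bar> ^ 6 = v ^ 3" by (simp add: v_def power_mult[symmetric] power_even_abs)
    \<comment> \<open>This is the factored form of 4 (1 + v^3) - (1 + v)^3.\<close>
    have "0 \<le> 3 * (1 + v) * (v - 1)\<^sup>2" using v by simp
    then have "(1 + v) ^ 3 \<le> 4 * (1 + v ^ 3)"
      by (simp add: power2_eq_square power3_eq_cube algebra_simps)
    then have "norm (\<phi> u) * (1 + v) ^ 3 \<le> norm (\<phi> u) * (4 * (1 + v ^ 3))"
      by (rule mult_left_mono) simp
    also have "\<dots> \<le> K"
      using K0[of u] K6[of u] \<open>\<bar>u\<bar> ^ 6 = v ^ 3\<close> by (simp add: K_def algebra_simps)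
    finally show ?thesis
      using v by (simp add: decay_def v_def[symmetric] power_divide field_simps)
  qed
  ultimately show "\<exists>K>0. \<forall>u. norm (\<phi> u) \<le> K * decay u ^ 3" by blast
qed

text \<open>The estimates are made for Borel functions, so f is replaced by a Borel function equal
  to it almost everywhere; coefficients and norm stay the same.\<close>

lemma ex_borel_representative:
  fixes f :: "real \<Rightarrow> complex"
  assumes f: "f \<in> borel_measurable lebesgue"
  shows "\<exists>g\<in>borel_measurable borel. AE x in lebesgue. f x = g x"
proof -
  have "(\<lambda>x. Re (f x)) \<in> borel_measurable lebesgue" "(\<lambda>x. Im (f x)) \<in> borel_measurable lebesgue"
    using f by auto
  from this[THEN completion_ex_borel_measurable_real]
  obtain g1 g2 where g: "g1 \<in> borel_measurable borel" "g2 \<in> borel_measurable borel"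
    "AE x in lborel. Re (f x) = g1 x" "AE x in lborel. Im (f x) = g2 x" by auto
  have "AE x in lborel. f x = Complex (g1 x) (g2 x)"
    using g(3,4) by eventually_elim (simp add: complex_eq_iff)
  then have "AE x in lebesgue. f x = Complex (g1 x) (g2 x)"
    by (rule AE_completion)
  moreover have "(\<lambda>x. Complex (g1 x) (g2 x)) \<in> borel_measurable borel"
    unfolding Complex_eq using g(1,2) by measurable
  ultimately show ?thesis by (rule bexI)
qed

text \<open>Connects the unordered sum in the theorem with the series form in which sums over tents
  are interchanged with integrals.\<close>

lemma infsum_ennreal_eq_suminf:
  fixes g :: "nat \<Rightarrow> ennreal"
  shows "(\<Sum>\<^sub>\<infinity>k\<in>I. g k) = (\<Sum>k. if k \<in> I then g k else 0)"
proof -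
  have "(\<Sum>\<^sub>\<infinity>k\<in>I. g k) = (\<Sum>\<^sub>\<infinity>k. if k \<in> I then g k else 0)"
    by (rule infsum_cong_neutral) auto
  moreover have "(\<lambda>k. if k \<in> I then g k else 0) sums (\<Sum>\<^sub>\<infinity>k. if k \<in> I then g k else 0)"
    by (intro has_sum_imp_sums has_sum_infsum nonneg_summable_on_complete) auto
  ultimately show ?thesis by (simp add: sums_unique)
qed

text \<open>Both locale conditions rest on \<open>far\<close>: a much smaller q within \<beta> / t'
  in frequency of a point of \<open>T k\<close> lies outside the cross-section of tent k at its own
  height. For \<open>slice\<close>, the two windows of radius 2 (\<beta> / 4) / t1 and 2 (\<beta> /
  4) / t2 have total radius at most \<beta> / t1 when t1 is the smaller scale.\<close>

lemma well_separated_imp_separated_tents: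
  assumes W: "band_limited_window \<phi> K (\<beta> / 4)" and b: "0 < b" "b < min C1 C2"
    and ws: "well_separated (C1, C2, b) \<alpha> \<beta> B I x \<xi> s T"
    and P: "P \<in> sets borel" "P \<subseteq> (\<Union>k\<in>I. T k)"
  shows "separated_tents \<phi> K (\<beta> / 4) B P C1 C2 b I x \<xi> s"
proof -
  interpret W: band_limited_window \<phi> K "\<beta> / 4" by fact
  have \<alpha>: "1 \<le> \<alpha>" and \<beta>: "0 < \<beta>" and B: "1 < B" using ws by (auto simp: well_separated_def)
  have T: "0 < s k" "T k \<subseteq> tent (C1, C2, b) (x k) (\<xi> k) (s k)" if "k \<in> I" for k
    using ws that by (auto simp: well_separated_def partial_tents_def)
  have sep: "\<beta> / t' < \<bar>\<eta> - \<eta>'\<bar> \<or> \<alpha> * (s k - t') < \<bar>x k - y'\<bar>"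
    if "k \<in> I" "(y, \<eta>, t) \<in> T k" "(y', \<eta>', t') \<in> P" "B * t' < t" for k y \<eta> t y' \<eta>' t'
  proof -
    have "\<forall>k\<in>I. \<forall>(y, \<eta>, t) \<in> T k. \<forall>(y', \<eta>', t') \<in> (\<Union>j\<in>I. T j).
        B * t' < t \<longrightarrow> \<beta> / t' < \<bar>\<eta> - \<eta>'\<bar> \<or> \<alpha> * (s k - t') < \<bar>x k - y'\<bar>"
      using ws[unfolded well_separated_def] by (elim conjE)
    from bspec[OF bspec[OF this that(1)] that(2)] show ?thesis
      using bspec[of "\<Union>j\<in>I. T j" _ "(y', \<eta>', t')"] subsetD[OF P(2) that(3)] that(4) by fastforce
  qed
  have inT: "\<exists>k\<in>I. p \<in> T k" if "p \<in> P" for p using P(2) that by auto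
  have far: "s k - t' < \<bar>x k - y'\<bar>"
    if "k \<in> I" "(y, \<eta>, t) \<in> T k" "(y', \<eta>', t') \<in> P" "B * t' < t" "0 < t'" "\<bar>\<eta> - \<eta>'\<bar> \<le> \<beta> / t'" for k y \<eta> t y' \<eta>' t'
  proof -
    have "t < s k" using T(2)[OF that(1)] that(2) by (auto simp: tent_def)
    moreover have "t' < B * t'" using B that(5) by simp
    ultimately have "0 \<le> s k - t'" using that(4) by linarith
    \<comment> \<open>As s k - t' is nonnegative, \<alpha> >= 1 only enlarges the distance and may
      be replaced by 1.\<close>
    then have "s k - t' \<le> \<alpha> * (s k - t')" using \<alpha> mult_right_mono[of 1 \<alpha>] by simp
    then show ?thesis using sep[OF that(1-4)] that(6) by linarith
  qed
  have pos: "0 < t" if "(y, \<eta>, t) \<in> P" for y \<eta> t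
    using inT[OF that] T(2) by (fastforce simp: tent_def)
  show ?thesis
  proof unfold_locales
    fix y \<eta> \<eta>1 t1 \<eta>2 t2
    assume 1: "(y, \<eta>1, t1) \<in> P" and 2: "(y, \<eta>2, t2) \<in> P"
      and close: "\<bar>\<eta> - \<eta>1\<bar> < 2 * (\<beta> / 4) / t1" "\<bar>\<eta> - \<eta>2\<bar> < 2 * (\<beta> / 4) / t2"
    show "t2 \<le> B * t1"
    proof (rule ccontr)
      assume "\<not> t2 \<le> B * t1"
      then have lt: "B * t1 < t2" by simp
      have t1: "0 < t1" using pos[OF 1] .
      have "t1 < B * t1" using B t1 by simp
      then have t12: "t1 < t2" using lt by simp
      \<comment> \<open>The tent is taken from the point of larger scale. \<open>far\<close> puts y
        outside its cross-section at height t1, yet y lies in the narrower cross-section at the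
        greater height t2.\<close>
      obtain k where k: "k \<in> I" "(y, \<eta>2, t2) \<in> T k" using inT[OF 2] by blast
      have "2 * (\<beta> / 4) / t2 \<le> 2 * (\<beta> / 4) / t1"
        using t1 t12 \<beta> by (intro divide_left_mono) auto
      moreover have "\<beta> / t1 = 2 * (\<beta> / 4) / t1 + 2 * (\<beta> / 4) / t1" by simp
      ultimately have "\<bar>\<eta>2 - \<eta>1\<bar> \<le> \<beta> / t1" using close by linarith
      from far[OF k 1 lt t1 this] have "s k - t1 < \<bar>x k - y\<bar>" .
      moreover have "\<bar>y - x k\<bar> < s k - t2" using T(2)[OF k(1)] k(2) by (auto simp: tent_def)
      ultimately show False using t12 by linarith
    qed
  next
    fix p assume p: "p \<in> P"
    obtain y \<eta> t where p_eq: "p = (y, \<eta>, t)" by (cases p)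
    obtain k where k: "k \<in> I" "(y, \<eta>, t) \<in> T k" using inT[OF p] p_eq by blast
    have "s k - t' < \<bar>x k - y'\<bar>"
      if q: "(y', \<eta>', t') \<in> P" "B * t' < t" "\<bar>\<eta> - \<eta>'\<bar> < 2 * (\<beta> / 4) / t'" for y' \<eta>' t'
    proof -
      have "2 * (\<beta> / 4) / t' \<le> \<beta> / t'" using pos[OF q(1)] \<beta> by (intro divide_right_mono) auto
      then show ?thesis using far[OF k q(1,2) pos[OF q(1)]] q(3) by linarith
    qed
    then show "\<exists>k\<in>I. p \<in> tent (C1, C2, b) (x k) (\<xi> k) (s k) \<and>
      (\<forall>q\<in>P. B * snd (snd q) < snd (snd p) \<longrightarrow> \<bar>fst (snd p) - fst (snd q)\<bar> < 2 * (\<beta> / 4) / snd (snd q) \<longrightarrow> s k - snd (snd q) < \<bar>x k - fst q\<bar>)"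
      using T(2)[OF k(1)] k by (intro bexI[of _ k]) (auto simp: p_eq)
  qed (use B P(1) pos b T(1) in auto)
qed

theorem lemma3:
  fixes \<phi> :: "real \<Rightarrow> complex" and C1 C2 b B \<beta> \<sigma> :: real
  assumes "0 < b" and "b < min C1 C2"
    and "schwartz \<phi>"
    and "1 < B" and "0 < \<beta>"
    and "0 < \<sigma>" and "\<sigma> < 1"
  shows "\<exists>C>0. \<forall>(\<delta>::real) (\<alpha>::real) (I::nat set) (x::nat \<Rightarrow> real) (\<xi>::nat \<Rightarrow> real) (s::nat \<Rightarrow> real)
            (T::nat \<Rightarrow> (real \<times> real \<times> real) set) (f::real \<Rightarrow> complex).
    supp (fourier \<phi>) \<subseteq> {-\<delta><..<\<delta>} \<longrightarrow> 4 * \<delta> \<le> \<beta> \<longrightarrow>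
    well_separated (C1, C2, b) \<alpha> \<beta> B I x \<xi> s T \<longrightarrow> in_L2 f \<longrightarrow>
    ennpow (\<integral>\<^sup>+p \<in> (\<Union>k\<in>I. T k). ennreal ((norm (L2_inner f (wave_packet \<phi> p)))\<^sup>2) \<partial>lebesgue) (1 / 2)
    \<le> ennreal C *
       (ennreal (norm_L2 f) +
        ennpow ((SUP p \<in> (\<Union>k\<in>I. T k). ennreal (norm (L2_inner f (wave_packet \<phi> p)))) *
                ennpow (\<Sum>\<^sub>\<infinity>k\<in>I. ennreal (s k)) (1 / 2)) \<sigma> *
        ennreal (norm_L2 f powr (1 - \<sigma>)))"
proof -
  obtain K where K: "0 < K" "\<And>u. norm (\<phi> u) \<le> K * decay u ^ 3"
    using schwartz_decay(2)[OF assms(3)] by blast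
  \<comment> \<open>c0 and \<kappa> are \<open>schur_const\<close> and \<open>tent_const\<close> for
    the band limit \<beta> / 4. They are fixed before \<delta> is, and \<phi> enters them only
    through K.\<close>
  define c0 where "c0 = 16 * pi\<^sup>2 * K\<^sup>2 * (\<beta> / 4) * B\<^sup>2"
  define \<kappa> where "\<kappa> = 2 * pi * (C1 + C2) / (1 - 1 / B)"
  define C where "C = sqrt (2 * c0 + \<kappa>) + sqrt (4 * c0 / (1 - 2 powr (- (2 * \<sigma>))))"
  have "0 < c0" using K assms by (simp add: c0_def)
  moreover have "0 < \<kappa>" using assms by (simp add: \<kappa>_def)
  moreover have "2 powr (- (2 * \<sigma>)) < 1" using assms powr_less_mono[of "- (2 * \<sigma>)" 0 2] by simp
  ultimately have C: "0 < C" by (simp add: C_def add_pos_nonneg)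
  show ?thesis
  proof (intro exI[of _ C] conjI allI impI)
    fix \<delta> \<alpha> :: real and I :: "nat set" and x \<xi> s :: "nat \<Rightarrow> real" and T :: "nat \<Rightarrow> (real \<times> real \<times> real) set" and f :: "real \<Rightarrow> complex"
    assume supp: "supp (fourier \<phi>) \<subseteq> {-\<delta><..<\<delta>}" and \<delta>: "4 * \<delta> \<le> \<beta>"
      and ws: "well_separated (C1, C2, b) \<alpha> \<beta> B I x \<xi> s T" and f: "in_L2 f"
    define U where "U = (\<Union>k\<in>I. T k)"
    define M where "M = (SUP p \<in> U. ennreal (norm (L2_inner f (wave_packet \<phi> p))))"
    define \<Sigma> where "\<Sigma> = (\<Sum>\<^sub>\<infinity>k\<in>I. ennreal (s k))"
    have \<phi>_meas: "\<phi> \<in> borel_measurable borel"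
      using schwartz_decay(1)[OF assms(3)] by (rule borel_measurable_continuous_onI)
    \<comment> \<open>The support lies in (-\<delta>, \<delta>) with \<delta> <= \<beta> / 4. The
      radius \<beta> / 4 is positive as the locale requires, whereas \<delta> may be nonpositive
      when the support is empty.\<close>
    have band: "(LBINT x. iexp (- (\<omega> * x)) * \<phi> x) = 0" if "\<beta> / 4 \<le> \<bar>\<omega>\<bar>" for \<omega>
    proof -
      have [measurable]: "(\<lambda>x. exp (- (\<i> * complex_of_real (\<omega> * x))) * \<phi> x) \<in> borel_measurable lborel"
        using \<phi>_meas by measurable
      have "fourier \<phi> \<omega> = (LBINT x. exp (- (\<i> * complex_of_real (\<omega> * x))) * \<phi> x)"
        unfolding fourier_def by (rule integral_completion) measurable
      moreover have "fourier \<phi> \<omega> = 0"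
      proof (rule ccontr)
        assume "fourier \<phi> \<omega> \<noteq> 0"
        then have "\<omega> \<in> supp (fourier \<phi>)" unfolding supp_def using closure_subset by fastforce
        with supp have "\<bar>\<omega>\<bar> < \<delta>" by (auto simp: abs_less_iff)
        then show False using \<delta> that by linarith
      qed
      ultimately show ?thesis by simp
    qed
    interpret W: band_limited_window \<phi> K "\<beta> / 4"
      using schwartz_decay(1)[OF assms(3)] K band assms(5) by unfold_locales auto
    obtain g where g [measurable]: "g \<in> borel_measurable borel" and fg: "AE x in lebesgue. f x = g x"
      using ex_borel_representative f unfolding in_L2_def by blast
    have inner: "L2_inner f (wave_packet \<phi> p) = W.coeff g p" for p
    proof -
      have "L2_inner f (wave_packet \<phi> p) = (LINT x|lebesgue. g x * cnj (wave_packet \<phi> p x))"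
        unfolding L2_inner_def
      proof (rule integral_cong_AE)
        have [measurable]: "f \<in> borel_measurable lebesgue" using f by (simp add: in_L2_def)
        have [measurable]: "wave_packet \<phi> p \<in> borel_measurable lebesgue" "g \<in> borel_measurable lebesgue"
          by (auto intro!: measurable_completion)
        show "(\<lambda>x. f x * cnj (wave_packet \<phi> p x)) \<in> borel_measurable lebesgue"
          "(\<lambda>x. g x * cnj (wave_packet \<phi> p x)) \<in> borel_measurable lebesgue" by measurable
      qed (use fg in eventually_elim, simp)
      also have "\<dots> = W.coeff g p"
        unfolding W.coeff_def by (rule integral_completion) measurable
      finally show ?thesis .
    qed
    have g2': "integrable lebesgue (\<lambda>x. (norm (g x))\<^sup>2)"
    proof (rule integrable_cong_AE_imp)
      show "integrable lebesgue (\<lambda>x. (norm (f x))\<^sup>2)" using f by (simp add: in_L2_def)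
      show "(\<lambda>x. (norm (g x))\<^sup>2) \<in> borel_measurable lebesgue" by (rule measurable_completion) measurable
      show "AE x in lebesgue. (norm (f x))\<^sup>2 = (norm (g x))\<^sup>2" using fg by eventually_elim simp
    qed
    then have g2: "integrable lborel (\<lambda>x. (norm (g x))\<^sup>2)"
      by (subst (asm) integrable_completion) auto
    have norm_f: "norm_L2 f = sqrt (LBINT x. (norm (g x))\<^sup>2)"
    proof -
      have "(LINT x|lebesgue. (norm (f x))\<^sup>2) = (LINT x|lebesgue. (norm (g x))\<^sup>2)"
        by (rule integral_cong_AE) (use f g2' fg in \<open>auto simp: in_L2_def\<close>)
      also have "\<dots> = (LBINT x. (norm (g x))\<^sup>2)"
        by (rule integral_completion) measurable
      finally show ?thesis by (simp add: norm_L2_def)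
    qed
    have U: "U \<in> sets lebesgue"
      unfolding U_def using ws by (intro sets.countable_UN') (auto simp: well_separated_def partial_tents_def)
    \<comment> \<open>U is only known to be Lebesgue measurable. Its Borel part P carries the same
      energy and, being a subset of U, inherits the separation and the supremum bound.\<close>
    then obtain P Z where P: "fsigma P" "Z \<in> null_sets lebesgue" "P \<union> Z = U" "disjnt P Z"
      by (rule lebesgue_set_almost_fsigma)
    have P_borel [measurable]: "P \<in> sets borel" using P(1) by (auto elim!: fsigma.cases)
    have PU: "P \<subseteq> U" using P(3) by auto
    have "(\<integral>\<^sup>+p \<in> U. ennreal ((norm (L2_inner f (wave_packet \<phi> p)))\<^sup>2) \<partial>lebesgue)
      = (\<integral>\<^sup>+p. indicator P p * ennreal ((norm (W.coeff g p))\<^sup>2) \<partial>lebesgue)"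
      unfolding inner
    proof (rule nn_integral_cong_AE)
      show "AE p in lebesgue. ennreal ((norm (W.coeff g p))\<^sup>2) * indicator U p = indicator P p * ennreal ((norm (W.coeff g p))\<^sup>2)"
        using AE_not_in[OF P(2)] by eventually_elim (use P(3) in \<open>auto simp: indicator_def\<close>)
    qed
    also have "\<dots> = W.energy g P"
      unfolding W.energy_def nn_integral_completion ..
    finally have LHS: "(\<integral>\<^sup>+p \<in> U. ennreal ((norm (L2_inner f (wave_packet \<phi> p)))\<^sup>2) \<partial>lebesgue) = W.energy g P" .
    have T: "separated_tents \<phi> K (\<beta> / 4) B P C1 C2 b I x \<xi> s"
      by (rule well_separated_imp_separated_tents[OF W.band_limited_window_axioms assms(1,2) ws P_borel PU[unfolded U_def]])
    then interpret T: separated_tents \<phi> K "\<beta> / 4" B P C1 C2 b I x \<xi> s .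
    have le_M: "ennreal (norm (W.coeff g p)) \<le> M" if "p \<in> P" for p
      unfolding M_def inner using PU that by (intro SUP_upper) auto
    have bound: "ennpow (W.energy g P) (1 / 2)
      \<le> ennreal C * (ennreal (norm_L2 f) + ennpow (M * ennpow \<Sigma> (1 / 2)) \<sigma> * ennreal (norm_L2 f powr (1 - \<sigma>)))"
    \<comment> \<open>If all coefficients vanish the left side is 0. Otherwise M, \<Sigma> and the
      norm of f are all nonzero, which excludes products of the form 0 times \<infinity>, equal to
      0, on the right.\<close>
    proof (cases "(\<forall>p\<in>P. W.coeff g p = 0)")
      case True
      then have "W.energy g P = 0" by (auto simp: W.energy_def nn_integral_0_iff_AE indicator_def)
      then show ?thesis by (simp add: ennpow_def)
    next
      case False
      then obtain p where p: "p \<in> P" "W.coeff g p \<noteq> 0" by auto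
      have M0: "M \<noteq> 0" using le_M[OF p(1)] p(2) by auto
      obtain k where k: "k \<in> I" using PU p(1) by (auto simp: U_def)
      have \<Sigma>_eq: "\<Sigma> = (\<Sum>k. if k \<in> I then ennreal (s k) else 0)"
        unfolding \<Sigma>_def by (rule infsum_ennreal_eq_suminf)
      have "ennreal (s k) \<le> \<Sigma>"
        unfolding \<Sigma>_eq using sum_le_suminf[of "\<lambda>k. if k \<in> I then ennreal (s k) else 0" "{k}"] k by simp
      then have \<Sigma>0: "\<Sigma> \<noteq> 0" using T.s_pos[OF k] by auto
      have "norm_L2 f \<noteq> 0"
      proof
        assume "norm_L2 f = 0"
        then have "AE x in lborel. (norm (g x))\<^sup>2 = 0"
          using integral_nonneg_eq_0_iff_AE[OF g2] by (simp add: norm_f)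
        then have "AE x in lborel. g x * cnj (wave_packet \<phi> p x) = 0" by eventually_elim simp
        then have "W.coeff g p = 0" unfolding W.coeff_def by (rule integral_eq_zero_AE)
        with p show False by simp
      qed
      moreover have "0 \<le> norm_L2 f" by (simp add: norm_L2_def)
      ultimately have N: "0 < norm_L2 f" by simp
      show ?thesis
      \<comment> \<open>In the infinite case the right side is \<infinity>, since none of its
        factors is 0.\<close>
      proof (cases "M = \<infinity> \<or> \<Sigma> = \<infinity>")
        case True
        have "ennpow \<Sigma> (1 / 2) \<noteq> 0"
          using \<Sigma>0 by (cases \<Sigma>) (auto simp: ennpow_def)
        then have "M * ennpow \<Sigma> (1 / 2) = \<infinity>"
          using True M0 by (auto simp: ennreal_mult_eq_top_iff ennpow_def)
        then show ?thesis using N C by (simp add: ennpow_def ennreal_mult_eq_top_iff ennreal_top_mult ennreal_mult_top)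
      next
        case False
        then obtain A S where AS: "M = ennreal A" "0 \<le> A" "\<Sigma> = ennreal S" "0 \<le> S"
          by (cases M; cases \<Sigma>) auto
        have A: "0 < A" and S: "0 < S" using M0 \<Sigma>0 AS by (auto simp: less_le)
        have "ennpow (W.energy g P) (1 / 2) \<le> ennreal (C * (norm_L2 f + (A * sqrt S) powr \<sigma> * norm_L2 f powr (1 - \<sigma>)))"
        proof -
          have "norm (W.coeff g p) \<le> A" if "p \<in> P" for p
            using le_M[OF that] AS by simp
          then show ?thesis
            using T.sqrt_energy_bound[OF g g2 A _ _ S norm_f[symmetric] N assms(6)] AS(3) \<Sigma>_eq
            by (simp add: C_def c0_def \<kappa>_def T.schur_const_def T.tent_const_def)
        qed
        also have "\<dots> = ennreal C * (ennreal (norm_L2 f) + ennpow (M * ennpow \<Sigma> (1 / 2)) \<sigma> * ennreal (norm_L2 f powr (1 - \<sigma>)))"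
        proof -
          have "ennpow \<Sigma> (1 / 2) = ennreal (sqrt S)" using AS by (simp add: ennpow_def powr_half_sqrt)
          then have "ennpow (M * ennpow \<Sigma> (1 / 2)) \<sigma> = ennreal ((A * sqrt S) powr \<sigma>)"
            using AS by (simp add: ennpow_def ennreal_mult[symmetric])
          then show ?thesis
            using C N by (simp add: ennreal_mult[symmetric] ennreal_plus[symmetric] del: ennreal_plus)
        qed
        finally show ?thesis .
      qed
    qed
    show "ennpow (\<integral>\<^sup>+p \<in> (\<Union>k\<in>I. T k). ennreal ((norm (L2_inner f (wave_packet \<phi> p)))\<^sup>2) \<partial>lebesgue) (1 / 2)
    \<le> ennreal C *
       (ennreal (norm_L2 f) +
        ennpow ((SUP p \<in> (\<Union>k\<in>I. T k). ennreal (norm (L2_inner f (wave_packet \<phi> p)))) *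
                ennpow (\<Sum>\<^sub>\<infinity>k\<in>I. ennreal (s k)) (1 / 2)) \<sigma> *
        ennreal (norm_L2 f powr (1 - \<sigma>)))"
      using bound unfolding LHS[symmetric] unfolding U_def M_def \<Sigma>_def .
  qed (rule C)
qed

end
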